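(* Fix real numbers $a,c$ with $c\neq a$, a noise variance $K_W>0$ and a power level $\kappa>0$. For $(\Lambda,K_Z)\in(-\infty,\infty)\times[0,\infty)$ put $A=c$, $C=\Lambda+c-a$, $R=K_Z+K_W$, $A^*=c-K_WR^{-1}C$, $B=1-K_W(K_Z+K_W)^{-1}$, $B^{*,1/2}=K_W^{1/2}B^{1/2}$. Let $$\mathcal P^\infty=\{(\Lambda,K_Z)\in(-\infty,\infty)\times[0,\infty):\ \{A,C\}\text{ is detectable and }\{A^*,B^{*,1/2}\}\text{ is stabilizable}\},$$ and for $(\Lambda,K_Z)\in\mathcal P^\infty$ let $K^\infty=K^\infty(\Lambda,K_Z)\ge 0$ denote the unique stabilizing solution of the algebraic Riccati equation $$K=c^2K+K_W-\frac{\big(K_W+cK(\Lambda+c-a)\big)^2}{K_Z+K_W+(\Lambda+c-a)^2K}.$$ Let $$\mathcal P^\infty(\kappa)=\{(\Lambda,K_Z)\in\mathcal P^\infty:\ \Lambda^2K^\infty+K_Z\le\kappa\}$$ and suppose $\mathcal P^\infty(\kappa)\neq\emptyset$. Then, when the supremum defining $C^\infty(\kappa,s)$ is taken over $(\Lambda,K_Z)\in\mathcal P^\infty$, one has for every initial state $s\in\mathbb R$ $$C^\infty(\kappa,s)=C^\infty(\kappa):=\sup_{(\Lambda,K_Z)\in\mathcal P^\infty(\kappa)}\frac12\log\Big(\frac{(\Lambda+c-a)^2K^\infty+K_Z+K_W}{K_W}\Big),$$ which does not depend on $s$. Moreover, a maximizing element $(\Lambda,K_Z)\in\mathcal P^\infty(\kappa)$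 has the following properties: (i) if $|c|<1$, the processes $(S_t,V_t,X_t,Y_t)_{t\ge1}$ it generates are asymptotically stationary; (ii) for all $a,c\in(-\infty,\infty)$, the processes $(X_t,I_t)_{t\ge1}$ it generates are asymptotically stationary.
   Context: Channel and noise: the additive Gaussian noise channel $Y_t=X_t+V_t$, $t=1,2,\dots$, where the noise is ARMA$(a,c)$ in state form: $S_{t+1}=cS_t+W_t$, $V_t=(c-a)S_t+W_t$, $S_1=s$ (initial state, known to encoder and decoder), with $W_t\sim N(0,K_W)$ mutually independent and independent of the initial state. Time-invariant feedback input strategies: $X_1=Z_1$ and $X_t=\Lambda(S_t-\widehat S_t)+Z_t$ for $t\ge2$, where $\widehat S_t=\mathbf E\{S_t\mid Y^{t-1},S_1=s\}$, $(\Lambda,K_Z)\in(-\infty,\infty)\times[0,\infty)$ are nonrandom, and $Z_t\sim N(0,K_Z)$ are mutually independent and $Z_t$ is independent of $(V^{t-1},X^{t-1},Y^{t-1},S_1)$. The innovation is $I_t=Y_t-(c-a)\widehat S_t$. The error variance $K^o_t=\mathbf E\{(S_t-\widehat S_t)^2\mid S_1=s\}$ satisfies the difference Riccati equation $K^o_{t+1}=c^2K^o_t+K_W-\frac{(K_W+cK^o_t(\Lambda+c-a))^2}{K_Z+K_W+(\Lambda+c-a)^2K^o_t}$, $K^o_1=0$. The feedback rate is $$C^\infty(\kappa,s)=\sup\ \lim_{n\to\infty}\frac1{2n}\sum_{t=1}^n\log\Big(\frac{(\Lambda+c-a)^2K^o_t+K_Z+K_W}{K_W}\Big),$$ the supremum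 over $(\Lambda,K_Z)$ with $\lim_{n\to\infty}\frac1n\sum_{t=1}^n(\Lambda^2K^o_t+K_Z)\le\kappa$ (this expression equals $\lim_n\frac1n[H(Y^n\mid s)-H(V^n\mid s)]$ with power $\lim_n\frac1n\mathbf E\{\sum_t X_t^2\mid s\}$). Detectability: $\{A,C\}$ is detectable if there is $G\in\mathbb R$ with $|A-GC|<1$. Stabilizability: $\{A^*,B^{*,1/2}\}$ is stabilizable if there is $G\in\mathbb R$ with $|A^*-B^{*,1/2}G|<1$. A solution $K\ge0$ of the algebraic Riccati equation is stabilizing if $|F|<1$, where $F=c-M(\Lambda+c-a)$ and $M=\frac{K_W+cK(\Lambda+c-a)}{K_Z+K_W+(\Lambda+c-a)^2K}$. *)

theory Defs
  imports "HOL-Probability.Probability"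
begin

definition ric :: "real \<Rightarrow> real \<Rightarrow> real \<Rightarrow> real \<Rightarrow> real \<Rightarrow> real \<Rightarrow> real" where
  "ric a c KW Lam KZ K =
     c\<^sup>2 * K + KW - (KW + c * K * (Lam + c - a))\<^sup>2 / (KZ + KW + (Lam + c - a)\<^sup>2 * K)"

definition gainM :: "real \<Rightarrow> real \<Rightarrow> real \<Rightarrow> real \<Rightarrow> real \<Rightarrow> real \<Rightarrow> real" where
  "gainM a c KW Lam KZ K = (KW + c * K * (Lam + c - a)) / (KZ + KW + (Lam + c - a)\<^sup>2 * K)"

definition closedF :: "real \<Rightarrow> real \<Rightarrow> real \<Rightarrow> real \<Rightarrow> real \<Rightarrow> real \<Rightarrow> real" where
  "closedF a c KW Lam KZ K = c - gainM a c KW Lam KZ K * (Lam + c - a)"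

text \<open>Error variances: Kop n is K^o_{n+1}; Ko t = K^o_t for t >= 1.\<close>
primrec Kop :: "real \<Rightarrow> real \<Rightarrow> real \<Rightarrow> real \<Rightarrow> real \<Rightarrow> nat \<Rightarrow> real" where
  "Kop a c KW Lam KZ 0 = 0"
| "Kop a c KW Lam KZ (Suc n) = ric a c KW Lam KZ (Kop a c KW Lam KZ n)"

definition Ko :: "real \<Rightarrow> real \<Rightarrow> real \<Rightarrow> real \<Rightarrow> real \<Rightarrow> nat \<Rightarrow> real" where
  "Ko a c KW Lam KZ t = Kop a c KW Lam KZ (t - 1)"

definition detectable :: "real \<Rightarrow> real \<Rightarrow> bool" where
  "detectable A C \<longleftrightarrow> (\<exists>G. \<bar>A - G * C\<bar> < 1)"

definition stabilizable :: "real \<Rightarrow> real \<Rightarrow> bool" where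
  "stabilizable Ast Bh \<longleftrightarrow> (\<exists>G. \<bar>Ast - Bh * G\<bar> < 1)"

definition Pinf :: "real \<Rightarrow> real \<Rightarrow> real \<Rightarrow> (real \<times> real) set" where
  "Pinf a c KW = {(Lam, KZ). KZ \<ge> 0 \<and>
      (let A = c; C = Lam + c - a; R = KZ + KW;
           Ast = c - KW * inverse R * C;
           B = 1 - KW * inverse (KZ + KW);
           Bh = sqrt KW * sqrt B
       in detectable A C \<and> stabilizable Ast Bh)}"

definition stab_sol :: "real \<Rightarrow> real \<Rightarrow> real \<Rightarrow> real \<Rightarrow> real \<Rightarrow> real \<Rightarrow> bool" where
  "stab_sol a c KW Lam KZ K \<longleftrightarrow>
     K \<ge> 0 \<and> K = ric a c KW Lam KZ K \<and> \<bar>closedF a c KW Lam KZ K\<bar> < 1"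

definition Kinf :: "real \<Rightarrow> real \<Rightarrow> real \<Rightarrow> real \<Rightarrow> real \<Rightarrow> real" where
  "Kinf a c KW Lam KZ = (THE K. stab_sol a c KW Lam KZ K)"

definition Pinf_k :: "real \<Rightarrow> real \<Rightarrow> real \<Rightarrow> real \<Rightarrow> (real \<times> real) set" where
  "Pinf_k a c KW kappa = {(Lam, KZ) \<in> Pinf a c KW.
      Lam\<^sup>2 * Kinf a c KW Lam KZ + KZ \<le> kappa}"

definition stat_rate :: "real \<Rightarrow> real \<Rightarrow> real \<Rightarrow> real \<Rightarrow> real \<Rightarrow> real" where
  "stat_rate a c KW Lam KZ =
     1/2 * ln (((Lam + c - a)\<^sup>2 * Kinf a c KW Lam KZ + KZ + KW) / KW)"

definition C_inf :: "real \<Rightarrow> real \<Rightarrow> real \<Rightarrow> real \<Rightarrow> ereal" where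
  "C_inf a c KW kappa = (SUP p \<in> Pinf_k a c KW kappa. ereal (stat_rate a c KW (fst p) (snd p)))"

definition avg_power :: "real \<Rightarrow> real \<Rightarrow> real \<Rightarrow> real \<Rightarrow> real \<Rightarrow> nat \<Rightarrow> real" where
  "avg_power a c KW Lam KZ n =
     (1 / real n) * (\<Sum>t=1..n. Lam\<^sup>2 * Ko a c KW Lam KZ t + KZ)"

definition avg_rate :: "real \<Rightarrow> real \<Rightarrow> real \<Rightarrow> real \<Rightarrow> real \<Rightarrow> nat \<Rightarrow> real" where
  "avg_rate a c KW Lam KZ n =
     (1 / (2 * real n)) *
       (\<Sum>t=1..n. ln (((Lam + c - a)\<^sup>2 * Ko a c KW Lam KZ t + KZ + KW) / KW))"

text \<open>Feedback rate C^infinity(kappa, s), the supremum taken over (Lam,KZ) in Pinf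
  satisfying the (limiting) power constraint.  (The defining expression does not
  involve the initial state s, since K^o_1 = 0 for every s.)\<close>
definition C_fb :: "real \<Rightarrow> real \<Rightarrow> real \<Rightarrow> real \<Rightarrow> real \<Rightarrow> ereal" where
  "C_fb a c KW kappa s =
     (SUP p \<in> {(Lam, KZ) \<in> Pinf a c KW.
                 \<exists>P. avg_power a c KW Lam KZ \<longlonglongrightarrow> P \<and> P \<le> kappa}.
        ereal (lim (avg_rate a c KW (fst p) (snd p))))"

definition is_maximizer :: "real \<Rightarrow> real \<Rightarrow> real \<Rightarrow> real \<Rightarrow> real \<Rightarrow> real \<Rightarrow> bool" where
  "is_maximizer a c KW kappa Lam KZ \<longleftrightarrow>
     (Lam, KZ) \<in> Pinf_k a c KW kappa \<and>
     ereal (stat_rate a c KW Lam KZ) = C_inf a c KW kappa"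

definition gauss_rv :: "'w measure \<Rightarrow> ('w \<Rightarrow> real) \<Rightarrow> real \<Rightarrow> bool" where
  "gauss_rv M X v \<longleftrightarrow>
     (if v = 0 then X \<in> borel_measurable M \<and> (AE \<omega> in M. X \<omega> = 0)
      else distributed M lborel X (normal_density 0 (sqrt v)))"

definition noise_model :: "'w measure \<Rightarrow> real \<Rightarrow> real \<Rightarrow>
    (nat \<Rightarrow> 'w \<Rightarrow> real) \<Rightarrow> (nat \<Rightarrow> 'w \<Rightarrow> real) \<Rightarrow> bool" where
  "noise_model M KW KZ W Z \<longleftrightarrow>
     prob_space M \<and>
     (\<forall>t\<ge>1. gauss_rv M (W t) KW \<and> gauss_rv M (Z t) KZ) \<and>
     prob_space.indep_vars M (\<lambda>_. borel) (\<lambda>i. case i of Inl t \<Rightarrow> W t | Inr t \<Rightarrow> Z t)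
        (Inl ` {1..} \<union> Inr ` {1..})"

text \<open>State: Sst n = S_{n+1}; S t = S_t for t >= 1.\<close>
primrec Sst :: "real \<Rightarrow> real \<Rightarrow> (nat \<Rightarrow> 'w \<Rightarrow> real) \<Rightarrow> nat \<Rightarrow> 'w \<Rightarrow> real" where
  "Sst c s W 0 = (\<lambda>_. s)"
| "Sst c s W (Suc n) = (\<lambda>\<omega>. c * Sst c s W n \<omega> + W (Suc n) \<omega>)"

definition Sproc :: "real \<Rightarrow> real \<Rightarrow> (nat \<Rightarrow> 'w \<Rightarrow> real) \<Rightarrow> nat \<Rightarrow> 'w \<Rightarrow> real" where
  "Sproc c s W t = Sst c s W (t - 1)"

definition Vproc :: "real \<Rightarrow> real \<Rightarrow> real \<Rightarrow> (nat \<Rightarrow> 'w \<Rightarrow> real) \<Rightarrow> nat \<Rightarrow> 'w \<Rightarrow> real" where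
  "Vproc a c s W t = (\<lambda>\<omega>. (c - a) * Sproc c s W t \<omega> + W t \<omega>)"

definition past_sigma :: "'w measure \<Rightarrow> (nat \<Rightarrow> 'w \<Rightarrow> real) \<Rightarrow> nat \<Rightarrow> 'w measure" where
  "past_sigma M Y n =
     sigma (space M) {Y i -` B \<inter> space M | i B. 1 \<le> i \<and> i < n \<and> B \<in> sets borel}"

text \<open>Yh n i = Y_i for 1 <= i <= n (outputs generated recursively; the input at time t
  uses the conditional estimate of S_t given Y_1..Y_{t-1}, S_1 = s).\<close>
primrec Yh :: "'w measure \<Rightarrow> real \<Rightarrow> real \<Rightarrow> real \<Rightarrow> real \<Rightarrow>
    (nat \<Rightarrow> 'w \<Rightarrow> real) \<Rightarrow> (nat \<Rightarrow> 'w \<Rightarrow> real) \<Rightarrow> nat \<Rightarrow> nat \<Rightarrow> 'w \<Rightarrow> real" where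
  "Yh M a c Lam s W Z 0 = (\<lambda>_ _. 0)"
| "Yh M a c Lam s W Z (Suc n) = (Yh M a c Lam s W Z n)(Suc n :=
     (\<lambda>\<omega>. (if n = 0 then Z 1 \<omega>
            else Lam * (Sproc c s W (Suc n) \<omega>
                   - real_cond_exp M (past_sigma M (Yh M a c Lam s W Z n) (Suc n))
                                     (Sproc c s W (Suc n)) \<omega>)
                 + Z (Suc n) \<omega>)
           + Vproc a c s W (Suc n) \<omega>))"

definition Yproc where
  "Yproc M a c Lam s W Z t = Yh M a c Lam s W Z t t"

definition Shat where
  "Shat M a c Lam s W Z t =
     real_cond_exp M (past_sigma M (Yproc M a c Lam s W Z) t) (Sproc c s W t)"

definition Xproc where
  "Xproc M a c Lam s W Z t =
     (if t \<le> 1 then Z t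
      else (\<lambda>\<omega>. Lam * (Sproc c s W t \<omega> - Shat M a c Lam s W Z t \<omega>) + Z t \<omega>))"

definition Iproc where
  "Iproc M a c Lam s W Z t =
     (\<lambda>\<omega>. Yproc M a c Lam s W Z t \<omega> - (c - a) * Shat M a c Lam s W Z t \<omega>)"

definition asymp_stationary :: "'w measure \<Rightarrow> nat \<Rightarrow> (nat \<Rightarrow> nat \<Rightarrow> 'w \<Rightarrow> real) \<Rightarrow> bool" where
  "asymp_stationary M d U \<longleftrightarrow>
     (\<forall>m. \<exists>\<nu>. prob_space \<nu> \<and>
        sets \<nu> = sets (PiM ({..<d} \<times> {..<m}) (\<lambda>_. borel)) \<and>
        (\<forall>f :: (nat \<times> nat \<Rightarrow> real) \<Rightarrow> real.
            continuous_on UNIV f \<and> bounded (range f) \<longrightarrow>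
            (\<lambda>t. \<integral>\<omega>. f (restrict (\<lambda>(j, i). U j (t + i) \<omega>) ({..<d} \<times> {..<m})) \<partial>M)
              \<longlonglongrightarrow> (\<integral>x. f x \<partial>\<nu>)))"

end

(* The Riccati map is increasing and K = 0 lies below its only nonnegative fixed point, so the
   error variances increase to the stabilizing solution and the Cesaro averages of power and rate
   converge to their stationary values; hence both suprema range over the same set.
   For the stationarity, the Kalman filter is verified directly: the linear error recursion is
   independent of the past outputs, because characteristic functions factorise (the next error
   and the innovation are uncorrelated) and a bounded density whose Fourier transform vanishes is
   null. A window of the processes at time n + 1 is then a function of the independent Gaussian
   variables est n, err n and the noises, whose parameters and coefficients converge; realising
   these variables as affine images of standard normals turns convergence in law into pointwise
   convergence. *)
theory Submission
  imports Defs
begin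

section \<open>The Riccati recursion\<close>

text \<open>The obstacle is that the input is defined through \<open>real_cond_exp\<close>, which is
  fixed only up to null sets: the true outputs \<open>Yproc\<close> and the outputs
  \<open>obs\<close> of the linear recursion agree almost everywhere, but may generate different
  sigma-algebras. So independence is proved for \<open>obs\<close>, and the conditional expectation
  is carried over through almost-everywhere versions of events. Joint densities are not at hand,
  because \<open>KZ = 0\<close> and vanishing error variances are allowed; characteristic functions
  and affine images of standard normals treat point masses and proper Gaussians alike. The two
  halves of membership in \<open>Pinf\<close> act at different places: detectability bounds the
  error variances, and for \<open>KZ = 0\<close> stabilizability excludes nonzero fixed points. The
  condition |c| < 1 enters through \<open>est\<close>, whose mean and variance may otherwise
  diverge; input and innovation are functions of \<open>err\<close> and the noises alone, which is
  why their stationarity holds for all a and c.\<close>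

text \<open>Process and measurement noise are decorrelated here: with \<open>R = KZ + KW\<close> and
  the notation of \<open>Pinf\<close>, the squared factor is \<open>R * Ast\<close> and the last
  summand is the square of \<open>Bh\<close>. Now K occurs in a single increasing fraction, from
  which monotonicity, boundedness and uniqueness can be read off.\<close>

lemma ric_eq:
  assumes "KW > 0" "KZ \<ge> 0" "K \<ge> 0"
  shows "ric a c KW Lam KZ K =
    (c * (KZ + KW) - KW * (Lam + c - a))\<^sup>2 * K / ((KZ + KW) * (KZ + KW + (Lam + c - a)\<^sup>2 * K))
    + KW * KZ / (KZ + KW)"
proof -
  define R C where "R = KZ + KW" and "C = Lam + c - a"
  define D where "D = R + C\<^sup>2 * K"
  have R: "R > 0" and D: "D > 0" unfolding R_def D_def using assms by (auto intro: add_pos_nonneg)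
  have KZ: "KZ = R - KW" by (simp add: R_def)
  have "c\<^sup>2 * K + KW - (KW + c * K * C)\<^sup>2 / D
    = (c * R - KW * C)\<^sup>2 * K / (R * D) + KW * (R - KW) / R"
    using R D by (simp add: divide_simps) (unfold D_def, algebra)
  then show ?thesis unfolding ric_def D_def C_def KZ[symmetric] by (simp add: R_def)
qed

text \<open>The numerator is the squared factor of \<open>ric_eq\<close>, so a fixed-point equation
  becomes a bound on the closed-loop factor.\<close>

lemma closedF_eq:
  assumes "KW > 0" "KZ \<ge> 0" "K \<ge> 0"
  shows "closedF a c KW Lam KZ K =
    (c * (KZ + KW) - KW * (Lam + c - a)) / (KZ + KW + (Lam + c - a)\<^sup>2 * K)"
proof -
  define C where "C = Lam + c - a"
  have D: "KZ + KW + C\<^sup>2 * K > 0" using assms by (intro add_pos_nonneg add_nonneg_pos) auto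
  have "c - (KW + c * K * C) / (KZ + KW + C\<^sup>2 * K) * C = (c * (KZ + KW) - KW * C) / (KZ + KW + C\<^sup>2 * K)"
    using D by (simp add: field_simps power2_eq_square)
  then show ?thesis unfolding closedF_def gainM_def C_def .
qed

text \<open>Joseph form: the variance of the filtering error is a sum of the variances of its
  independent contributions.\<close>
lemma ric_joseph:
  assumes "KW > 0" "KZ \<ge> 0" "K \<ge> 0"
  shows "ric a c KW Lam KZ K =
    (closedF a c KW Lam KZ K)\<^sup>2 * K + (1 - gainM a c KW Lam KZ K)\<^sup>2 * KW
      + (gainM a c KW Lam KZ K)\<^sup>2 * KZ"
proof -
  define C where "C = Lam + c - a"
  define D where "D = KZ + KW + C\<^sup>2 * K"
  define Mg where "Mg = (KW + c * K * C) / D"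
  have D: "D > 0" unfolding D_def using assms by (intro add_pos_nonneg add_nonneg_pos) auto
  have MD: "Mg * D = KW + c * K * C" using D by (simp add: Mg_def)
  have "(KW + c * K * C)\<^sup>2 / D = Mg * (KW + c * K * C)"
    by (simp add: Mg_def power2_eq_square)
  then have "c\<^sup>2 * K + KW - (KW + c * K * C)\<^sup>2 / D
    = (c - Mg * C)\<^sup>2 * K + (1 - Mg)\<^sup>2 * KW + Mg\<^sup>2 * KZ"
    using MD unfolding D_def by algebra
  then show ?thesis unfolding ric_def closedF_def gainM_def Mg_def D_def C_def .
qed

text \<open>The next error and the current innovation are uncorrelated.\<close>
lemma gainM_orthogonal:
  assumes "KW > 0" "KZ \<ge> 0" "K \<ge> 0"
  shows "closedF a c KW Lam KZ K * (Lam + c - a) * K + (1 - gainM a c KW Lam KZ K) * KW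
      - gainM a c KW Lam KZ K * KZ = 0"
proof -
  define C where "C = Lam + c - a"
  define D where "D = KZ + KW + C\<^sup>2 * K"
  define Mg where "Mg = (KW + c * K * C) / D"
  have D: "D > 0" unfolding D_def using assms by (intro add_pos_nonneg add_nonneg_pos) auto
  have MD: "Mg * D = KW + c * K * C" using D by (simp add: Mg_def)
  have "(c - Mg * C) * C * K + (1 - Mg) * KW - Mg * KZ = 0"
    using MD unfolding D_def by algebra
  then show ?thesis unfolding closedF_def gainM_def Mg_def D_def C_def .
qed

lemma ric_nonneg:
  assumes "KW > 0" "KZ \<ge> 0" "K \<ge> 0"
  shows "ric a c KW Lam KZ K \<ge> 0"
  unfolding ric_joseph[OF assms] using assms by auto

lemma ric_mono:
  assumes "KW > 0" "KZ \<ge> 0" "0 \<le> K" "K \<le> K'"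
  shows "ric a c KW Lam KZ K \<le> ric a c KW Lam KZ K'"
proof -
  define R q where "R = KZ + KW" and "q = (Lam + c - a)\<^sup>2"
  have R: "R > 0" and q: "q \<ge> 0" using assms by (auto simp: R_def q_def)
  have D: "R + q * K > 0" "R + q * K' > 0" using R q assms by (auto intro!: add_pos_nonneg)
  \<comment> \<open>The terms with \<open>K * K'\<close> cancel, leaving
    \<open>R\<^sup>2 * K \<le> R\<^sup>2 * K'\<close>.\<close>
  have "K * (R * (R + q * K')) \<le> K' * (R * (R + q * K))"
    using assms R by (simp add: algebra_simps)
  then have "K / (R * (R + q * K)) \<le> K' / (R * (R + q * K'))"
    using D R by (simp add: frac_le_eq divide_le_eq_1 pos_divide_le_eq pos_le_divide_eq)
  from mult_left_mono[OF this, of "(c * R - KW * (Lam + c - a))\<^sup>2"]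
  show ?thesis
    using assms by (simp add: ric_eq R_def q_def)
qed

text \<open>In the scalar case the feedback \<open>G = A / C\<close> cancels \<open>A\<close>
  whenever the second entry is nonzero, so a condition remains only where \<open>C\<close> or
  \<open>Bh\<close> vanishes. The latter happens exactly for \<open>KZ = 0\<close>, and then
  \<open>Ast\<close> is \<open>a - Lam\<close>.\<close>

lemma Pinf_iff:
  assumes "KW > 0"
  shows "(Lam, KZ) \<in> Pinf a c KW \<longleftrightarrow> KZ \<ge> 0 \<and> (Lam + c - a = 0 \<longrightarrow> \<bar>c\<bar> < 1)
    \<and> (KZ = 0 \<longrightarrow> \<bar>a - Lam\<bar> < 1)"
proof -
  have det: "detectable c C \<longleftrightarrow> (C = 0 \<longrightarrow> \<bar>c\<bar> < 1)" for C
    unfolding detectable_def by (cases "C = 0") (auto intro!: exI[of _ "c / C"])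
  have st: "stabilizable A b \<longleftrightarrow> (b = 0 \<longrightarrow> \<bar>A\<bar> < 1)" for A b
    unfolding stabilizable_def by (cases "b = 0") (auto intro!: exI[of _ "A / b"])
  show ?thesis
  proof (cases "KZ \<ge> 0")
    case True
    then have "1 - KW * inverse (KZ + KW) = 0 \<longleftrightarrow> KZ = 0"
      using assms by (auto simp: field_simps)
    then show ?thesis using assms True
      by (auto simp: Pinf_def Let_def det st)
  qed (auto simp: Pinf_def)
qed

text \<open>By \<open>closedF_eq\<close> stability means |\<beta>| < D. For \<open>KZ = 0\<close>
  this is stabilizability, because \<beta> is then R times \<open>a - Lam\<close>; for
  \<open>KZ > 0\<close> the positive constant in the fixed-point equation forces it.\<close>

lemma stab_sol_if_fixpoint:
  assumes KW: "KW > 0" and P: "(Lam, KZ) \<in> Pinf a c KW"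
    and K: "K \<ge> 0" "K = ric a c KW Lam KZ K"
  shows "stab_sol a c KW Lam KZ K"
proof -
  define R C where "R = KZ + KW" and "C = Lam + c - a"
  define \<beta> where "\<beta> = c * R - KW * C"
  define D where "D = R + C\<^sup>2 * K"
  have KZ: "KZ \<ge> 0" using P KW by (simp add: Pinf_iff)
  have R: "R > 0" and DR: "D \<ge> R" using KW KZ K by (auto simp: R_def D_def)
  have F: "closedF a c KW Lam KZ K = \<beta> / D"
    using closedF_eq[OF KW KZ K(1)] by (simp add: \<beta>_def D_def R_def C_def)
  have eq: "K = \<beta>\<^sup>2 * K / (R * D) + KW * KZ / R"
    using K ric_eq[OF KW KZ K(1), of a c Lam] by (simp add: \<beta>_def D_def R_def C_def)
  have "\<beta>\<^sup>2 < D\<^sup>2"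
  proof (cases "KZ = 0")
    case True
    then have "\<beta> = R * (a - Lam)" by (simp add: \<beta>_def R_def C_def algebra_simps)
    moreover have "(a - Lam)\<^sup>2 < 1"
      using True P KW by (auto simp: Pinf_iff abs_square_less_1)
    ultimately have "\<beta>\<^sup>2 < R\<^sup>2" using R by (simp add: power_mult_distrib)
    also have "\<dots> \<le> D\<^sup>2" using R DR by (intro power_mono) auto
    finally show ?thesis .
  next
    case False
    then have Q: "KW * KZ / R > 0" using KW KZ R by simp
    then have Kp: "K > 0" using eq R DR K(1) by (smt (verit) divide_nonneg_nonneg mult_nonneg_nonneg zero_le_power2)
    \<comment> \<open>The fixed-point equation solved for its positive constant
      \<open>KW * KZ / R\<close>.\<close>
    have "K * (1 - \<beta>\<^sup>2 / (R * D)) > 0" using eq Q by (simp add: algebra_simps)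
    then have "\<beta>\<^sup>2 / (R * D) < 1" using Kp by (simp add: zero_less_mult_iff)
    then have "\<beta>\<^sup>2 < R * D" using R DR by (simp add: divide_simps split: if_splits)
    also have "\<dots> \<le> D\<^sup>2" using R DR by (simp add: power2_eq_square)
    finally show ?thesis .
  qed
  then have "\<bar>\<beta>\<bar> < D" using R DR by (metis abs_le_square_iff abs_of_pos less_le_trans not_less)
  then have "\<bar>closedF a c KW Lam KZ K\<bar> < 1" unfolding F using R DR by simp
  then show ?thesis using K by (simp add: stab_sol_def)
qed

lemma ric_fixpoint_unique:
  assumes KW: "KW > 0" and P: "(Lam, KZ) \<in> Pinf a c KW"
    and K: "K \<ge> 0" "K = ric a c KW Lam KZ K" and L: "L \<ge> 0" "L = ric a c KW Lam KZ L"
  shows "K = L"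
proof -
  define R q where "R = KZ + KW" and "q = (Lam + c - a)\<^sup>2"
  define \<beta> where "\<beta> = c * R - KW * (Lam + c - a)"
  have KZ: "KZ \<ge> 0" using P KW by (simp add: Pinf_iff)
  have R: "R > 0" and q: "q \<ge> 0" using KW KZ by (auto simp: R_def q_def)
  have eq: "x = \<beta>\<^sup>2 * x / (R * (R + q * x)) + KW * KZ / R" if "x \<ge> 0" "x = ric a c KW Lam KZ x" for x
    using that ric_eq[OF KW KZ that(1), of a c Lam] by (simp add: \<beta>_def q_def R_def)
  show ?thesis
  proof (cases "KZ = 0")
    case True
    have "x = 0" if x: "x \<ge> 0" "x = ric a c KW Lam KZ x" for x
    proof (rule ccontr)
      assume "x \<noteq> 0"
      have "\<beta> = R * (a - Lam)" using True by (simp add: \<beta>_def R_def algebra_simps)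
      moreover have "(a - Lam)\<^sup>2 < 1"
        using True P KW by (auto simp: Pinf_iff abs_square_less_1)
      ultimately have b: "\<beta>\<^sup>2 < R * R" using R by (simp add: power_mult_distrib power2_eq_square)
      have D: "R + q * x \<ge> R" using q x by simp
      have "x * (\<beta>\<^sup>2 / (R * (R + q * x))) = x * 1" using eq[OF x] True by (simp add: mult.commute)
      then have "\<beta>\<^sup>2 / (R * (R + q * x)) = 1" using \<open>x \<noteq> 0\<close> by (metis mult_cancel_left)
      then have "\<beta>\<^sup>2 = R * (R + q * x)" by (metis divide_eq_1_iff)
      moreover have "R * (R + q * x) \<ge> R * R" using R D by simp
      ultimately show False using b by simp
    qed
    then show ?thesis using K L by metis
  next
    case False
    have lt: False if x: "x \<ge> 0" "x = ric a c KW Lam KZ x" and y: "y \<ge> 0" "y = ric a c KW Lam KZ y"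
      and xy: "x < y" for x y
    proof -
      define u v where "u = 1 / (R * (R + q * x))" and "v = 1 / (R * (R + q * y))"
      have "v \<le> u" unfolding u_def v_def using R q x y xy
        by (intro divide_left_mono mult_left_mono mult_pos_pos add_pos_nonneg add_left_mono) auto
      have "x = \<beta>\<^sup>2 * x * u + KW * KZ / R" using eq[OF x] by (simp add: u_def)
      \<comment> \<open>Each equation is multiplied by the other fixed point instead of being
        divided by its own, because x is only known to be nonnegative.\<close>
      then have 1: "y * x = y * (\<beta>\<^sup>2 * x * u + KW * KZ / R)" by simp
      have "y = \<beta>\<^sup>2 * y * v + KW * KZ / R" using eq[OF y] by (simp add: v_def)
      then have 2: "x * y = x * (\<beta>\<^sup>2 * y * v + KW * KZ / R)" by simp
      have "(y - x) * (KW * KZ / R) = \<beta>\<^sup>2 * x * y * (v - u)" using 1 2 by algebra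
      moreover have "\<beta>\<^sup>2 * x * y * (v - u) \<le> 0" using x y \<open>v \<le> u\<close> by (intro mult_nonneg_nonpos) auto
      moreover have "(y - x) * (KW * KZ / R) > 0" using xy KW KZ R False by simp
      ultimately show False by linarith
    qed
    show ?thesis using lt K L by (metis linorder_neqE)
  qed
qed

section \<open>Convergence of the error variances\<close>

lemma Kop_nonneg:
  assumes "KW > 0" "KZ \<ge> 0"
  shows "Kop a c KW Lam KZ n \<ge> 0"
  by (induction n) (auto intro: ric_nonneg assms)

lemma Kop_incseq:
  assumes "KW > 0" "KZ \<ge> 0"
  shows "incseq (Kop a c KW Lam KZ)"
proof (rule incseq_SucI)
  fix n show "Kop a c KW Lam KZ n \<le> Kop a c KW Lam KZ (Suc n)"
  proof (induction n)
    case 0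
    then show ?case using ric_nonneg[OF assms, of 0] by simp
  next
    case (Suc n)
    then show ?case using ric_mono[OF assms Kop_nonneg[OF assms]] by simp
  qed
qed

text \<open>Some interval [0, b] is mapped into itself. If \<open>Lam + c - a\<close> is nonzero,
  the fraction in \<open>ric_eq\<close> saturates, which bounds the whole map; if it vanishes,
  detectability gives |c| < 1 and the map is an affine contraction, whose fixed point serves as
  b.\<close>

lemma Kop_bounded:
  assumes KW: "KW > 0" and P: "(Lam, KZ) \<in> Pinf a c KW"
  shows "\<exists>b. \<forall>n. Kop a c KW Lam KZ n \<le> b"
proof -
  define R q where "R = KZ + KW" and "q = (Lam + c - a)\<^sup>2"
  define \<beta> where "\<beta> = c * R - KW * (Lam + c - a)"
  have KZ: "KZ \<ge> 0" using P KW by (simp add: Pinf_iff)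
  have R: "R > 0" and q: "q \<ge> 0" using KW KZ by (auto simp: R_def q_def)
  define Q where "Q = KW * KZ / R"
  have Q: "Q \<ge> 0" using KW KZ R by (simp add: Q_def)
  have eq: "ric a c KW Lam KZ x = \<beta>\<^sup>2 * (x / (R * (R + q * x))) + Q" if "x \<ge> 0" for x
    using ric_eq[OF KW KZ that, of a c Lam] by (simp add: \<beta>_def q_def R_def Q_def)
  have "\<exists>b\<ge>0. \<forall>x. 0 \<le> x \<and> x \<le> b \<longrightarrow> ric a c KW Lam KZ x \<le> b"
  proof (cases "q = 0")
    case False
    have "x / (R * (R + q * x)) \<le> 1 / (R * q)" if "x \<ge> 0" for x
    proof -
      have "R + q * x > 0" using R q that by (intro add_pos_nonneg) auto
      then show ?thesis using R q that False by (simp add: divide_simps)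
    qed
    then have "ric a c KW Lam KZ x \<le> \<beta>\<^sup>2 * (1 / (R * q)) + Q" if "x \<ge> 0" for x
      using eq[OF that] mult_left_mono[of "x / (R * (R + q * x))" "1 / (R * q)" "\<beta>\<^sup>2"] that by simp
    moreover have "\<beta>\<^sup>2 * (1 / (R * q)) + Q \<ge> 0" using R q Q by simp
    ultimately show ?thesis by blast
  next
    case True
    then have C: "Lam + c - a = 0" by (simp add: q_def)
    then have c: "c\<^sup>2 < 1" using P KW by (simp add: Pinf_iff abs_square_less_1)
    have e: "ric a c KW Lam KZ x = c\<^sup>2 * x + Q" if "x \<ge> 0" for x
      using eq[OF that] True C R by (simp add: \<beta>_def power_mult_distrib power2_eq_square)
    have "Q / (1 - c\<^sup>2) \<ge> 0" using c Q by simp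
    moreover have "c\<^sup>2 * x + Q \<le> Q / (1 - c\<^sup>2)" if "x \<le> Q / (1 - c\<^sup>2)" for x
    proof -
      have "c\<^sup>2 * x \<le> c\<^sup>2 * (Q / (1 - c\<^sup>2))" using that by (intro mult_left_mono) auto
      also have "\<dots> = Q / (1 - c\<^sup>2) - Q" using c by (simp add: field_simps)
      finally show ?thesis by simp
    qed
    ultimately show ?thesis using e by metis
  qed
  then obtain b where b: "b \<ge> 0" "\<And>x. 0 \<le> x \<Longrightarrow> x \<le> b \<Longrightarrow> ric a c KW Lam KZ x \<le> b" by blast
  have "Kop a c KW Lam KZ n \<le> b" for n
    by (induction n) (use b Kop_nonneg[OF KW KZ] in auto)
  then show ?thesis by blast
qed

text \<open>The monotone limit is a nonnegative fixed point by continuity, hence stabilizing, and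
  uniqueness makes it the value of the description in \<open>Kinf\<close>. Existence of the
  stabilizing solution is thus obtained from the recursion itself.\<close>

lemma Kop_tendsto:
  assumes KW: "KW > 0" and P: "(Lam, KZ) \<in> Pinf a c KW"
  shows "Kop a c KW Lam KZ \<longlonglongrightarrow> Kinf a c KW Lam KZ"
    and "stab_sol a c KW Lam KZ (Kinf a c KW Lam KZ)"
proof -
  have KZ: "KZ \<ge> 0" using P KW by (simp add: Pinf_iff)
  obtain L where L: "Kop a c KW Lam KZ \<longlonglongrightarrow> L"
    using Kop_bounded[OF assms] incseq_convergent[OF Kop_incseq[OF KW KZ]] by metis
  have L0: "L \<ge> 0" using LIMSEQ_le_const[OF L] Kop_nonneg[OF KW KZ] by blast
  have D: "KZ + KW + (Lam + c - a)\<^sup>2 * L > 0" using KW KZ L0 by (intro add_nonneg_pos add_pos_nonneg) auto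
  have "(\<lambda>n. ric a c KW Lam KZ (Kop a c KW Lam KZ n)) \<longlonglongrightarrow> ric a c KW Lam KZ L"
    unfolding ric_def using D by (intro tendsto_intros L) auto
  moreover have "(\<lambda>n. ric a c KW Lam KZ (Kop a c KW Lam KZ n)) \<longlonglongrightarrow> L"
    using LIMSEQ_Suc[OF L] by simp
  ultimately have fp: "L = ric a c KW Lam KZ L" by (metis LIMSEQ_unique)
  have st: "stab_sol a c KW Lam KZ L" by (rule stab_sol_if_fixpoint[OF KW P L0 fp])
  have "Kinf a c KW Lam KZ = L" unfolding Kinf_def
    using st ric_fixpoint_unique[OF KW P _ _ L0 fp]
    by (intro the_equality) (auto simp: stab_sol_def)
  then show "Kop a c KW Lam KZ \<longlonglongrightarrow> Kinf a c KW Lam KZ"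
    "stab_sol a c KW Lam KZ (Kinf a c KW Lam KZ)" using L st by auto
qed

section \<open>Cesaro averages and the equality of the two suprema\<close>

lemma cesaro_mean_tendsto:
  fixes f :: "nat \<Rightarrow> real"
  assumes f: "f \<longlonglongrightarrow> L"
  shows "(\<lambda>n. (\<Sum>t<n. f t) / real n) \<longlonglongrightarrow> L"
proof (rule LIMSEQ_I)
  fix r :: real assume r: "r > 0"
  then obtain N where N: "\<And>n. n \<ge> N \<Longrightarrow> \<bar>f n - L\<bar> < r / 2"
    using LIMSEQ_D[OF f, of "r / 2"] by auto
  define B where "B = (\<Sum>t<N. \<bar>f t - L\<bar>)"
  have B: "B \<ge> 0" by (simp add: B_def sum_nonneg)
  \<comment> \<open>With this bound the fixed head \<open>B\<close> stays below
    \<open>n * r / 2\<close>; the tail supplies the other half.\<close>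
  obtain N' where N': "real N' > 2 * B / r" using reals_Archimedean2 by blast
  show "\<exists>no. \<forall>n\<ge>no. norm ((\<Sum>t<n. f t) / real n - L) < r"
  proof (intro exI allI impI)
    \<comment> \<open>\<open>Suc N\<close> instead of \<open>N\<close> keeps n positive for the
      division.\<close>
    fix n assume n: "n \<ge> max (Suc N) N'"
    then have n0: "real n > 0" by simp
    have "(\<Sum>t<n. f t) - real n * L = (\<Sum>t<n. f t - L)" by (simp add: sum_subtractf)
    then have "\<bar>(\<Sum>t<n. f t) - real n * L\<bar> \<le> (\<Sum>t<n. \<bar>f t - L\<bar>)" by simp
    also have "\<dots> = B + (\<Sum>t=N..<n. \<bar>f t - L\<bar>)"
      unfolding B_def lessThan_atLeast0 using n by (intro sum.atLeastLessThan_concat[symmetric]) auto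
    also have "(\<Sum>t=N..<n. \<bar>f t - L\<bar>) \<le> (\<Sum>t=N..<n. r / 2)"
      using N by (intro sum_mono) (auto intro: less_imp_le)
    also have "(\<Sum>t=N..<n. r / 2) \<le> real n * (r / 2)" using r n by simp
    also have "B < real n * (r / 2)"
    proof -
      have "2 * B / r < real n" using N' n by (smt (verit) max.bounded_iff of_nat_mono)
      then show ?thesis using r by (simp add: field_simps)
    qed
    finally have "\<bar>(\<Sum>t<n. f t) - real n * L\<bar> < real n * r" by (simp add: field_simps)
    moreover have "(\<Sum>t<n. f t) / real n - L = ((\<Sum>t<n. f t) - real n * L) / real n"
      using n0 by (simp add: field_simps)
    ultimately show "norm ((\<Sum>t<n. f t) / real n - L) < r"
      using n0 by (simp add: abs_divide field_simps)
  qed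
qed

lemma sum_Ko: "(\<Sum>t=1..n. h (Ko a c KW Lam KZ t)) = (\<Sum>t<n. h (Kop a c KW Lam KZ t))"
  by (rule sum.reindex_bij_witness[of _ Suc "\<lambda>t. t - 1"]) (auto simp: Ko_def)

lemma avg_power_tendsto:
  assumes KW: "KW > 0" and P: "(Lam, KZ) \<in> Pinf a c KW"
  shows "avg_power a c KW Lam KZ \<longlonglongrightarrow> Lam\<^sup>2 * Kinf a c KW Lam KZ + KZ"
proof -
  have "(\<lambda>n. Lam\<^sup>2 * Kop a c KW Lam KZ n + KZ) \<longlonglongrightarrow> Lam\<^sup>2 * Kinf a c KW Lam KZ + KZ"
    by (intro tendsto_intros Kop_tendsto assms)
  from cesaro_mean_tendsto[OF this] show ?thesis
    using sum_Ko[of "\<lambda>K. Lam\<^sup>2 * K + KZ"] by (simp add: avg_power_def[abs_def])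
qed

lemma avg_rate_tendsto:
  assumes KW: "KW > 0" and P: "(Lam, KZ) \<in> Pinf a c KW"
  shows "avg_rate a c KW Lam KZ \<longlonglongrightarrow> stat_rate a c KW Lam KZ"
proof -
  have KZ: "KZ \<ge> 0" using P KW by (simp add: Pinf_iff)
  have K: "Kinf a c KW Lam KZ \<ge> 0" using Kop_tendsto(2)[OF assms] by (simp add: stab_sol_def)
  have D: "(Lam + c - a)\<^sup>2 * Kinf a c KW Lam KZ + KZ + KW > 0"
    using KW KZ K by (intro add_nonneg_pos add_nonneg_nonneg mult_nonneg_nonneg) auto
  let ?h = "\<lambda>K. ln (((Lam + c - a)\<^sup>2 * K + KZ + KW) / KW)"
  have "(\<lambda>n. ?h (Kop a c KW Lam KZ n)) \<longlonglongrightarrow> ?h (Kinf a c KW Lam KZ)"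
    using D KW by (intro tendsto_intros Kop_tendsto assms) auto
  from tendsto_mult[OF tendsto_const cesaro_mean_tendsto[OF this], of "1/2"] show ?thesis
    using sum_Ko[of ?h] by (simp add: avg_rate_def[abs_def] stat_rate_def)
qed

text \<open>On \<open>Pinf\<close> the average power always converges, so the limit P in the
  constraint of \<open>C_fb\<close> can only be the stationary power. The index sets coincide, and
  the objective values agree because the average rate converges as well.\<close>

lemma C_fb_eq_C_inf:
  assumes KW: "KW > 0"
  shows "C_fb a c KW kappa s = C_inf a c KW kappa"
proof -
  have set: "{(Lam, KZ) \<in> Pinf a c KW. \<exists>P. avg_power a c KW Lam KZ \<longlonglongrightarrow> P \<and> P \<le> kappa}
      = Pinf_k a c KW kappa"
    unfolding Pinf_k_def using avg_power_tendsto[OF KW] LIMSEQ_unique by blast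
  show ?thesis unfolding C_fb_def C_inf_def set
  proof (rule SUP_cong[OF refl])
    fix p assume "p \<in> Pinf_k a c KW kappa"
    then have "(fst p, snd p) \<in> Pinf a c KW" by (auto simp: Pinf_k_def)
    from limI[OF avg_rate_tendsto[OF KW this]]
    show "ereal (lim (avg_rate a c KW (fst p) (snd p))) = ereal (stat_rate a c KW (fst p) (snd p))"
      by simp
  qed
qed

section \<open>Characteristic functions\<close>

text \<open>An affine image instead of a density, so that \<open>v = 0\<close> gives the point mass
  at \<mu>.\<close>

definition gauss :: "real \<Rightarrow> real \<Rightarrow> real measure" where
  "gauss \<mu> v = distr std_normal_distribution borel (\<lambda>x. \<mu> + sqrt v * x)"

text \<open>Characteristic function of the centred Gaussian law of variance v, written as a formula
  for every real v: in \<open>est_distr\<close> it is used at \<open>Svar n - K n\<close> before the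
  sign of that difference is known.\<close>

definition gchar :: "real \<Rightarrow> real \<Rightarrow> complex" where
  "gchar v u = complex_of_real (exp (- (v * u\<^sup>2) / 2))"

lemma gchar_mult: "gchar v u * gchar v' u' = complex_of_real (exp (- (v * u\<^sup>2 + v' * u'\<^sup>2) / 2))"
  by (simp add: gchar_def field_simps flip: of_real_mult exp_add)

lemma real_distribution_gauss [simp, intro]: "real_distribution (gauss \<mu> v)"
proof -
  interpret N: real_distribution std_normal_distribution by (rule real_dist_normal_dist)
  show ?thesis unfolding gauss_def by (rule N.real_distribution_distr) simp
qed

lemma iexp_add: "iexp (x + y) = iexp x * iexp y"
  by (simp add: exp_add distrib_left)

lemma char_gauss:
  assumes "v \<ge> 0"
  shows "char (gauss \<mu> v) u = iexp (u * \<mu>) * gchar v u"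
proof -
  interpret N: real_distribution std_normal_distribution by (rule real_dist_normal_dist)
  have "char (gauss \<mu> v) u = (CLINT x|std_normal_distribution. iexp (u * \<mu>) * iexp ((u * sqrt v) * x))"
    unfolding char_def gauss_def
    by (subst integral_distr) (auto simp: distrib_left exp_add mult.assoc)
  also have "\<dots> = iexp (u * \<mu>) * char std_normal_distribution (u * sqrt v)"
    unfolding char_def by (rule integral_mult_right_zero)
  finally show ?thesis using assms
    by (simp add: char_std_normal_distribution gchar_def power_mult_distrib mult.commute)
qed

text \<open>Reconciles the two branches of \<open>gauss_rv\<close>: a variable that vanishes almost
  surely has the law of the constant 0, and otherwise division by the standard deviation leads to
  the standard normal density.\<close>

lemma gauss_rv_distr:
  assumes "prob_space M" "gauss_rv M X v" "v \<ge> 0"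
  shows "X \<in> borel_measurable M" and "distr M borel X = gauss 0 v"
proof -
  interpret prob_space M by fact
  interpret N: real_distribution std_normal_distribution by (rule real_dist_normal_dist)
  have "X \<in> borel_measurable M \<and> distr M borel X = gauss 0 v"
  proof (cases "v = 0")
    case True
    then have X: "X \<in> borel_measurable M" "AE \<omega> in M. X \<omega> = 0"
      using assms by (auto simp: gauss_rv_def)
    have "distr M borel X = distr M borel (\<lambda>_. 0)"
      using X by (intro distr_cong_AE) auto
    also have "\<dots> = gauss 0 v"
      using True by (simp add: gauss_def distr_const N.distr_const)
    finally show ?thesis using X by simp
  next
    case False
    then have sv: "sqrt v > 0" using assms by simp
    have D: "distributed M lborel X (normal_density 0 (sqrt v))"
      using assms False by (simp add: gauss_rv_def)
    then have X: "X \<in> borel_measurable M" by (auto dest: distributed_measurable)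
    have "distributed M lborel (\<lambda>x. (X x - 0) / sqrt v) std_normal_density"
      using D normal_standard_normal_convert[OF sv, of X 0] by simp
    then have "distr M lborel (\<lambda>x. X x / sqrt v) = std_normal_distribution"
      by (auto dest: distributed_distr_eq_density)
    then have "gauss 0 v = distr (distr M lborel (\<lambda>x. X x / sqrt v)) borel (\<lambda>x. sqrt v * x)"
      by (simp add: gauss_def)
    also have "\<dots> = distr M borel X"
      using X sv by (subst distr_distr) (auto simp: comp_def)
    finally show ?thesis using X by simp
  qed
  then show "X \<in> borel_measurable M" "distr M borel X = gauss 0 v" by auto
qed

lemma gauss_mean_zero: "integrable (gauss 0 v) (\<lambda>x. x)" "(\<integral>x. x \<partial>gauss 0 v) = 0"
proof -
  have i: "integrable std_normal_distribution (\<lambda>x. x)"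
    using integrable_std_normal_distribution_moment[of 1] by simp
  have id: "(\<lambda>x::real. x) \<in> borel_measurable borel" by simp
  have m: "(\<lambda>x. 0 + sqrt v * x) \<in> borel_measurable std_normal_distribution" by simp
  show "integrable (gauss 0 v) (\<lambda>x. x)"
    unfolding gauss_def using integrable_mult_right[OF i, of "sqrt v"]
    by (subst integrable_distr_eq[OF m id]) (simp only: add_0)
  have "(\<integral>x. x \<partial>std_normal_distribution) = 0"
    using integral_std_normal_distribution_moment_odd[of 1] by simp
  then show "(\<integral>x. x \<partial>gauss 0 v) = 0"
    unfolding gauss_def
    by (subst integral_distr[OF m id]) (simp only: add_0 integral_mult_right_zero mult_zero_right)
qed

context prob_space
begin

lemma expectation_iexp_distr:
  assumes "X \<in> borel_measurable M" "distr M borel X = D"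
  shows "expectation (\<lambda>\<omega>. iexp (u * X \<omega>)) = char D u"
  using assms by (auto simp: char_def integral_distr)

lemma distr_eq_gaussI:
  assumes X: "X \<in> borel_measurable M" and v: "v \<ge> 0"
    and char: "\<And>u. expectation (\<lambda>\<omega>. iexp (u * X \<omega>)) = iexp (u * \<mu>) * gchar v u"
  shows "distr M borel X = gauss \<mu> v"
proof (rule Levy_uniqueness)
  show "char (distr M borel X) = char (gauss \<mu> v)"
    using X v char by (auto simp: char_gauss expectation_iexp_distr[OF X refl, symmetric])
qed (use X in auto)

lemma integrable_bounded:
  fixes f :: "'a \<Rightarrow> 'b::{banach, second_countable_topology}"
  assumes "f \<in> borel_measurable M" "\<And>x. norm (f x) \<le> b"
  shows "integrable M f"
  using assms by (intro integrable_const_bound[of _ b]) auto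

text \<open>Perturbing the constant density 1 by a multiple of \<open>h\<close> gives a second
  probability measure \<open>N\<close>. Under it \<open>Y\<close> has the same characteristic
  function as under \<open>M\<close>, hence the same law; comparing both on \<open>B\<close>
  isolates \<open>h\<close>.\<close>

lemma fourier_null_imp_null_real:
  fixes h :: "'a \<Rightarrow> real"
  assumes h [measurable]: "h \<in> borel_measurable M" and Y [measurable]: "Y \<in> borel_measurable M"
    and bd: "\<And>\<omega>. \<bar>h \<omega>\<bar> \<le> b"
    and zero: "\<And>u. expectation (\<lambda>\<omega>. complex_of_real (h \<omega>) * iexp (u * Y \<omega>)) = 0"
    and B [measurable]: "B \<in> sets borel"
  shows "expectation (\<lambda>\<omega>. h \<omega> * indicator B (Y \<omega>)) = 0"
proof -
  \<comment> \<open>The maximum with 1 makes the bound a positive divisor, so that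
    \<open>1 + h / b'\<close> is nonnegative.\<close>
  define b' where "b' = max b 1"
  have b': "b' > 0" "\<And>\<omega>. \<bar>h \<omega>\<bar> \<le> b'" using bd by (auto simp: b'_def le_max_iff_disj)
  define g where "g = (\<lambda>\<omega>. 1 + h \<omega> / b')"
  have g [measurable]: "g \<in> borel_measurable M" by (simp add: g_def)
  have g0: "g \<omega> \<ge> 0" for \<omega> using b'(1) b'(2)[of \<omega>] by (simp add: g_def field_simps abs_le_iff)
  have ih: "integrable M (\<lambda>\<omega>. h \<omega> * f \<omega>)" if "f \<in> borel_measurable M" "\<And>\<omega>. \<bar>f \<omega>\<bar> \<le> 1" for f :: "'a \<Rightarrow> real"
  proof (rule integrable_bounded)
    show "norm (h \<omega> * f \<omega>) \<le> b' * 1" for \<omega>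
      unfolding real_norm_def abs_mult using b' that by (intro mult_mono) auto
  qed (use that in measurable)
  \<comment> \<open>The transform at u = 0 shows that \<open>h\<close> has mean zero, which gives
    \<open>g\<close> total mass 1.\<close>
  have "complex_of_real (expectation h) = 0" using zero[of 0] by (simp del: of_real_eq_0_iff)
  then have Eh: "expectation h = 0" by simp
  have ig: "integrable M g" unfolding g_def using ih[of "\<lambda>_. 1"] by auto
  have Eg: "expectation g = 1" unfolding g_def using ih[of "\<lambda>_. 1"] Eh by (simp add: prob_space)
  define N where "N = density M g"
  have sN [measurable_cong]: "sets N = sets M" by (simp add: N_def)
  interpret N: prob_space N
  proof
    have "emeasure N (space N) = (\<integral>\<^sup>+\<omega>. ennreal (g \<omega>) \<partial>M)"
      unfolding N_def by (simp add: emeasure_density space_density cong: nn_integral_cong)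
    also have "\<dots> = 1" using ig Eg g0 by (subst nn_integral_eq_integral) auto
    finally show "emeasure N (space N) = 1" .
  qed
  have YN: "Y \<in> borel_measurable N" by simp
  have iY: "integrable M (\<lambda>\<omega>. iexp (u * Y \<omega>))" for u
    by (intro integrable_bounded[of _ 1]) auto
  have ihY: "integrable M (\<lambda>\<omega>. complex_of_real (h \<omega>) * iexp (u * Y \<omega>))" for u
    using b'(2) by (intro integrable_bounded[of _ b']) (auto simp: norm_mult)
  have "distr N borel Y = distr M borel Y"
  proof (rule Levy_uniqueness)
    have "char (distr N borel Y) u = char (distr M borel Y) u" for u
    proof -
      have "char (distr N borel Y) u = expectation (\<lambda>\<omega>. g \<omega> *\<^sub>R iexp (u * Y \<omega>))"
        unfolding char_def using YN g0 by (simp add: integral_distr N_def integral_density)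
      also have "\<dots> = expectation (\<lambda>\<omega>. iexp (u * Y \<omega>) + complex_of_real (1 / b') * (complex_of_real (h \<omega>) * iexp (u * Y \<omega>)))"
        by (intro Bochner_Integration.integral_cong) (auto simp: g_def scaleR_conv_of_real field_simps)
      also have "\<dots> = expectation (\<lambda>\<omega>. iexp (u * Y \<omega>))"
        using iY[of u] ihY[of u] zero[of u] by (subst Bochner_Integration.integral_add) auto
      finally show ?thesis by (simp add: char_def integral_distr)
    qed
    then show "char (distr N borel Y) = char (distr M borel Y)" by blast
  qed (use YN in auto)
  then have "N.expectation (\<lambda>\<omega>. indicator B (Y \<omega>) :: real) = expectation (\<lambda>\<omega>. indicator B (Y \<omega>))"
    using integral_distr[OF YN, of "indicator B :: real \<Rightarrow> real"]
      integral_distr[OF Y, of "indicator B :: real \<Rightarrow> real"] B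
    by (metis borel_measurable_indicator)
  moreover have "N.expectation (\<lambda>\<omega>. indicator B (Y \<omega>) :: real) = expectation (\<lambda>\<omega>. g \<omega> * indicator B (Y \<omega>))"
    using g0 unfolding N_def by (subst integral_density) auto
  moreover have "expectation (\<lambda>\<omega>. g \<omega> * indicator B (Y \<omega>)) =
      expectation (\<lambda>\<omega>. indicator B (Y \<omega>) + (1 / b') * (h \<omega> * indicator B (Y \<omega>)))"
    by (intro Bochner_Integration.integral_cong) (auto simp: g_def field_simps)
  moreover have "\<dots> = expectation (\<lambda>\<omega>. indicator B (Y \<omega>)) + (1 / b') * expectation (\<lambda>\<omega>. h \<omega> * indicator B (Y \<omega>))"
    using ih[of "\<lambda>\<omega>. indicator B (Y \<omega>)"]
    by (subst Bochner_Integration.integral_add) (auto intro!: integrable_bounded[of _ 1] simp: indicator_def)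
  ultimately show ?thesis using b' by simp
qed

text \<open>Real and imaginary parts are combinations of \<open>h\<close> and its conjugate, and the
  transform of the conjugate at u is the conjugate of the transform of \<open>h\<close> at
  -u.\<close>

lemma fourier_null_imp_null:
  fixes h :: "'a \<Rightarrow> complex"
  assumes h [measurable]: "h \<in> borel_measurable M" and Y [measurable]: "Y \<in> borel_measurable M"
    and bd: "\<And>\<omega>. norm (h \<omega>) \<le> b"
    and zero: "\<And>u. expectation (\<lambda>\<omega>. h \<omega> * iexp (u * Y \<omega>)) = 0"
    and B [measurable]: "B \<in> sets borel"
  shows "expectation (\<lambda>\<omega>. h \<omega> * indicator B (Y \<omega>)) = 0"
proof -
  have hc [measurable]: "(\<lambda>\<omega>. cnj (h \<omega>)) \<in> borel_measurable M"
    by (rule measurable_compose[OF h]) (intro borel_measurable_continuous_onI continuous_intros)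
  have i: "integrable M (\<lambda>\<omega>. h \<omega> * iexp (u * Y \<omega>))" for u
    using bd by (intro integrable_bounded[of _ b]) (auto simp: norm_mult)
  have cnj: "expectation (\<lambda>\<omega>. cnj (h \<omega>) * iexp (u * Y \<omega>)) = 0" for u
  proof -
    have "expectation (\<lambda>\<omega>. cnj (h \<omega>) * iexp (u * Y \<omega>)) = expectation (\<lambda>\<omega>. cnj (h \<omega> * iexp (- u * Y \<omega>)))"
      by (intro Bochner_Integration.integral_cong) (auto simp: exp_cnj)
    also have "\<dots> = 0" by (simp only: Bochner_Integration.integral_cnj zero complex_cnj_zero)
    finally show ?thesis .
  qed
  have ic: "integrable M (\<lambda>\<omega>. cnj (h \<omega>) * iexp (u * Y \<omega>))" for u
    using bd by (intro integrable_bounded[of _ b]) (auto simp: norm_mult)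
  have "expectation (\<lambda>\<omega>. Re (h \<omega>) * indicator B (Y \<omega>)) = 0"
  proof (rule fourier_null_imp_null_real)
    fix u
    have "expectation (\<lambda>\<omega>. complex_of_real (Re (h \<omega>)) * iexp (u * Y \<omega>)) =
       expectation (\<lambda>\<omega>. (h \<omega> * iexp (u * Y \<omega>) + cnj (h \<omega>) * iexp (u * Y \<omega>)) / 2)"
      by (intro Bochner_Integration.integral_cong refl)
        (simp add: complex_add_cnj flip: distrib_right)
    also have "\<dots> = 0" using i[of u] ic[of u] zero[of u] cnj[of u] by simp
    finally show "expectation (\<lambda>\<omega>. complex_of_real (Re (h \<omega>)) * iexp (u * Y \<omega>)) = 0" .
  qed (auto intro: order_trans[OF abs_Re_le_cmod bd])
  moreover have "expectation (\<lambda>\<omega>. Im (h \<omega>) * indicator B (Y \<omega>)) = 0"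
  proof (rule fourier_null_imp_null_real)
    fix u
    have "expectation (\<lambda>\<omega>. complex_of_real (Im (h \<omega>)) * iexp (u * Y \<omega>)) =
       expectation (\<lambda>\<omega>. (h \<omega> * iexp (u * Y \<omega>) - cnj (h \<omega>) * iexp (u * Y \<omega>)) / (2 * \<i>))"
      by (intro Bochner_Integration.integral_cong refl)
        (simp add: complex_diff_cnj mult_ac flip: left_diff_distrib)
    also have "\<dots> = 0" using i[of u] ic[of u] zero[of u] cnj[of u] by simp
    finally show "expectation (\<lambda>\<omega>. complex_of_real (Im (h \<omega>)) * iexp (u * Y \<omega>)) = 0" .
  qed (auto intro: order_trans[OF abs_Im_le_cmod bd])
  moreover have ii: "integrable M (\<lambda>\<omega>. h \<omega> * indicator B (Y \<omega>))"
    using bd order_trans[OF norm_ge_zero bd]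
    by (intro integrable_bounded[of _ b]) (auto simp: norm_mult indicator_def)
  moreover have Re_Im: "Re (h \<omega> * indicator B (Y \<omega>)) = Re (h \<omega>) * indicator B (Y \<omega>)"
    "Im (h \<omega> * indicator B (Y \<omega>)) = Im (h \<omega>) * indicator B (Y \<omega>)" for \<omega>
    by (auto simp: indicator_def)
  ultimately show ?thesis
    using integral_Re[OF ii] integral_Im[OF ii]
    by (intro complex_eqI) (simp_all only: Re_Im zero_complex.sel)
qed

end

section \<open>The Kalman filter\<close>

lemma past_sigma_sets:
  "sets (past_sigma M Y n) =
     sigma_sets (space M) {Y i -` B \<inter> space M | i B. 1 \<le> i \<and> i < n \<and> B \<in> sets borel}"
  "space (past_sigma M Y n) = space M"
  unfolding past_sigma_def by (auto intro!: sets_measure_of space_measure_of)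

lemma past_sigma_measurable:
  assumes "1 \<le> i" "i < n"
  shows "Y i \<in> borel_measurable (past_sigma M Y n)"
  using assms by (intro measurableI) (auto simp: past_sigma_sets intro!: sigma_sets.Basic)

lemma past_sigma_subset:
  assumes "space N = space M" "\<And>i. 1 \<le> i \<Longrightarrow> i < n \<Longrightarrow> Y i \<in> borel_measurable N"
  shows "sets (past_sigma M Y n) \<subseteq> sets N"
  unfolding past_sigma_sets assms(1)[symmetric]
proof (rule sets.sigma_sets_subset)
  show "{Y i -` B \<inter> space N |i B. 1 \<le> i \<and> i < n \<and> B \<in> sets borel} \<subseteq> sets N"
    using assms(2) by (auto intro: measurable_sets)
qed

lemma Int_stable_vimage: "Int_stable {X -` A \<inter> \<Omega> | A. A \<in> sets N}"
proof (rule Int_stableI)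
  fix P Q assume "P \<in> {X -` A \<inter> \<Omega> | A. A \<in> sets N}" "Q \<in> {X -` A \<inter> \<Omega> | A. A \<in> sets N}"
  then obtain A B where "P = X -` A \<inter> \<Omega>" "Q = X -` B \<inter> \<Omega>" "A \<in> sets N" "B \<in> sets N" by blast
  then have "P \<inter> Q = X -` (A \<inter> B) \<inter> \<Omega>" "A \<inter> B \<in> sets N" by auto
  then show "P \<inter> Q \<in> {X -` A \<inter> \<Omega> | A. A \<in> sets N}" by blast
qed

context prob_space
begin

text \<open>The events that have a version in the other sigma-algebra form a sigma-algebra
  containing the generators. This is the bridge between true outputs and \<open>obs\<close>.\<close>

lemma past_sigma_AE_version:
  assumes "\<And>i. 1 \<le> i \<Longrightarrow> i < n \<Longrightarrow> AE \<omega> in M. Y i \<omega> = Y' i \<omega>"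
    and "A \<in> sets (past_sigma M Y n)"
  shows "\<exists>A'\<in>sets (past_sigma M Y' n). AE \<omega> in M. \<omega> \<in> A \<longleftrightarrow> \<omega> \<in> A'"
  using assms(2) unfolding past_sigma_sets
proof (induction rule: sigma_sets.induct)
  case (Basic A)
  then obtain i B where A: "A = Y i -` B \<inter> space M" "1 \<le> i" "i < n" "B \<in> sets borel" by auto
  then have "AE \<omega> in M. \<omega> \<in> A \<longleftrightarrow> \<omega> \<in> Y' i -` B \<inter> space M"
    using assms(1)[of i] by auto
  then show ?case using A by (intro bexI[of _ "Y' i -` B \<inter> space M"]) (auto intro!: sigma_sets.Basic)
next
  case Empty
  show ?case by (auto intro!: bexI[OF _ sigma_sets.Empty])
next
  case (Compl A)
  then obtain A' where A': "A' \<in> sigma_sets (space M) {Y' i -` B \<inter> space M | i B. 1 \<le> i \<and> i < n \<and> B \<in> sets borel}"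
    "AE \<omega> in M. \<omega> \<in> A \<longleftrightarrow> \<omega> \<in> A'" by auto
  show ?case using A'(2) by (intro bexI[OF _ sigma_sets.Compl[OF A'(1)]]) auto
next
  case (Union A)
  let ?S = "sigma_sets (space M) {Y' i -` B \<inter> space M | i B. 1 \<le> i \<and> i < n \<and> B \<in> sets borel}"
  have "\<forall>i. \<exists>A'. A' \<in> ?S \<and> (AE \<omega> in M. \<omega> \<in> A i \<longleftrightarrow> \<omega> \<in> A')" using Union.IH by blast
  from choice[OF this] obtain A' where A': "\<And>i. A' i \<in> ?S"
    "\<And>i. AE \<omega> in M. \<omega> \<in> A i \<longleftrightarrow> \<omega> \<in> A' i" by blast
  have "AE \<omega> in M. \<forall>i. \<omega> \<in> A i \<longleftrightarrow> \<omega> \<in> A' i" using A'(2) by (simp add: AE_all_countable)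
  then show ?case by (intro bexI[OF _ sigma_sets.Union[of A'], OF _ A'(1)]) auto
qed

text \<open>Passes from independence of event families, the form kept in the induction over time, to
  independence of random variables, the form required by the product rule for expectations.\<close>

lemma indep_var_from_set:
  assumes ind: "indep_set (sets F) {e -` B \<inter> space M | B. B \<in> sets N}"
    and F: "subalgebra M F" and f: "f \<in> measurable F N'" and e: "e \<in> measurable M N" and g: "g \<in> measurable N N''"
  shows "indep_var N' f N'' (\<lambda>\<omega>. g (e \<omega>))"
  unfolding indep_var_def indep_vars_def2
proof
  have fM: "f \<in> measurable M N'" using measurable_from_subalg[OF F f] .
  show "\<forall>i\<in>UNIV. random_variable (case i of True \<Rightarrow> N' | False \<Rightarrow> N'') (case i of True \<Rightarrow> f | False \<Rightarrow> \<lambda>\<omega>. g (e \<omega>))"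
    using fM measurable_compose[OF e g] by (auto split: bool.split)
  have sp: "space F = space M" using F by (simp add: subalgebra_def)
  have "{f -` A \<inter> space M |A. A \<in> sets N'} \<subseteq> sets F"
    using measurable_sets[OF f] sp by auto
  moreover have "{(\<lambda>\<omega>. g (e \<omega>)) -` A \<inter> space M |A. A \<in> sets N''} \<subseteq> {e -` B \<inter> space M | B. B \<in> sets N}"
  proof safe
    fix A assume A: "A \<in> sets N''"
    have "(\<lambda>\<omega>. g (e \<omega>)) -` A \<inter> space M = e -` (g -` A \<inter> space N) \<inter> space M"
      using measurable_space[OF e] by auto
    then show "\<exists>B. (\<lambda>\<omega>. g (e \<omega>)) -` A \<inter> space M = e -` B \<inter> space M \<and> B \<in> sets N"
      using measurable_sets[OF g A] by blast
  qed
  ultimately show "indep_sets (\<lambda>i. {(case i of True \<Rightarrow> f | False \<Rightarrow> \<lambda>\<omega>. g (e \<omega>)) -` A \<inter> space M |A.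
      A \<in> sets (case i of True \<Rightarrow> N' | False \<Rightarrow> N'')}) UNIV"
    using ind unfolding indep_set_def
    by (elim indep_sets_mono_sets) (auto split: bool.splits)
qed

end

section \<open>The linear error recursion and its independence from the outputs\<close>

locale noisy_channel = prob_space M
  for M :: "'w measure" and a c KW Lam KZ s :: real and W Z :: "nat \<Rightarrow> 'w \<Rightarrow> real" +
  assumes KW: "KW > 0" and KZ: "KZ \<ge> 0" and noise: "noise_model M KW KZ W Z"
begin

abbreviation "K \<equiv> Kop a c KW Lam KZ"
abbreviation "F n \<equiv> closedF a c KW Lam KZ (K n)"
abbreviation "G n \<equiv> gainM a c KW Lam KZ (K n)"
abbreviation "S \<equiv> Sst c s W"

definition noise_rv :: "nat + nat \<Rightarrow> 'w \<Rightarrow> real" where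
  "noise_rv = case_sum W Z"

lemma noise_rv_simps [simp]: "noise_rv (Inl t) = W t" "noise_rv (Inr t) = Z t"
  by (auto simp: noise_rv_def)

text \<open>The index n is shifted as in Kop and Sst: err n is the filtering error of the state at
  time n + 1.\<close>
primrec err :: "nat \<Rightarrow> 'w \<Rightarrow> real" where
  "err 0 = (\<lambda>_. 0)"
| "err (Suc n) = (\<lambda>\<omega>. F n * err n \<omega> + (1 - G n) * W (Suc n) \<omega> - G n * Z (Suc n) \<omega>)"

definition est :: "nat \<Rightarrow> 'w \<Rightarrow> real" where
  "est n \<omega> = S n \<omega> - err n \<omega>"

text \<open>The outputs that arise if the error of the linear filter is fed back instead of the one
  defined by a conditional expectation; \<open>Yproc_AE\<close> identifies them with the true
  outputs. Since \<open>err 0\<close> is zero, the input at time 1 needs no separate clause.\<close>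

definition obs :: "nat \<Rightarrow> 'w \<Rightarrow> real" where
  "obs t \<omega> = Lam * err (t - 1) \<omega> + Z t \<omega> + Vproc a c s W t \<omega>"

text \<open>Generated by the noises and not by the outputs, so that states and errors are measurable
  for it while later noises are independent of it.\<close>

definition past :: "nat \<Rightarrow> 'w measure" where
  "past n = sigma (space M) (\<Union>i\<in>Inl ` {1..n} \<union> Inr ` {1..n}. {noise_rv i -` A \<inter> space M | A. A \<in> sets borel})"

abbreviation "outputs n \<equiv> past_sigma M obs (Suc n)"

lemma K_nonneg: "K n \<ge> 0" by (rule Kop_nonneg[OF KW KZ])

lemma W_distr: "t \<ge> 1 \<Longrightarrow> W t \<in> borel_measurable M" "t \<ge> 1 \<Longrightarrow> distr M borel (W t) = gauss 0 KW"
  and Z_distr: "t \<ge> 1 \<Longrightarrow> Z t \<in> borel_measurable M" "t \<ge> 1 \<Longrightarrow> distr M borel (Z t) = gauss 0 KZ"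
  using noise KW KZ gauss_rv_distr[OF prob_space_axioms] unfolding noise_model_def by auto

lemma W_Suc [measurable]: "W (Suc n) \<in> borel_measurable M" and Z_Suc [measurable]: "Z (Suc n) \<in> borel_measurable M"
  using W_distr(1) Z_distr(1) by auto

lemma noise_indep:
  "indep_sets (\<lambda>i. {noise_rv i -` A \<inter> space M | A. A \<in> sets borel}) (Inl ` {1..} \<union> Inr ` {1..})"
proof -
  have "(\<lambda>i. case i of Inl t \<Rightarrow> W t | Inr t \<Rightarrow> Z t) = noise_rv"
    by (auto simp: noise_rv_def)
  then show ?thesis using noise unfolding noise_model_def indep_vars_def2 by simp
qed

lemma past_sets:
  "sets (past n) = sigma_sets (space M) (\<Union>i\<in>Inl ` {1..n} \<union> Inr ` {1..n}. {noise_rv i -` A \<inter> space M | A. A \<in> sets borel})"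
  "space (past n) = space M"
  unfolding past_def by (auto intro!: sets_measure_of space_measure_of)

lemma past_subalgebra: "subalgebra M (past n)"
  unfolding subalgebra_def past_sets
proof (intro conjI sets.sigma_sets_subset refl)
  show "(\<Union>i\<in>Inl ` {1..n} \<union> Inr ` {1..n}. {noise_rv i -` A \<inter> space M | A. A \<in> sets borel}) \<subseteq> events"
    using W_distr(1) Z_distr(1) by (auto intro: measurable_sets)
qed

lemma past_mono: "n \<le> m \<Longrightarrow> sets (past n) \<subseteq> sets (past m)"
  unfolding past_sets by (intro sigma_sets_subseteq UN_mono) auto

lemma past_measurable_mono: "f \<in> measurable (past n) N \<Longrightarrow> n \<le> m \<Longrightarrow> f \<in> measurable (past m) N"
  using past_mono[of n m] by (auto simp: measurable_def past_sets(2))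

lemma past_W: "1 \<le> t \<Longrightarrow> t \<le> n \<Longrightarrow> W t \<in> borel_measurable (past n)"
  and past_Z: "1 \<le> t \<Longrightarrow> t \<le> n \<Longrightarrow> Z t \<in> borel_measurable (past n)"
proof -
  have "noise_rv i \<in> borel_measurable (past n)" if "i \<in> Inl ` {1..n} \<union> Inr ` {1..n}" for i
    using that by (intro measurableI) (auto simp: past_sets intro!: sigma_sets.Basic)
  from this[of "Inl t"] this[of "Inr t"] show "1 \<le> t \<Longrightarrow> t \<le> n \<Longrightarrow> W t \<in> borel_measurable (past n)"
    "1 \<le> t \<Longrightarrow> t \<le> n \<Longrightarrow> Z t \<in> borel_measurable (past n)" by auto
qed

lemma past_measurable: "f \<in> measurable (past n) N \<Longrightarrow> f \<in> measurable M N"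
  by (rule measurable_from_subalg[OF past_subalgebra])

lemma S_past: "S n \<in> borel_measurable (past n)"
proof (induction n)
  case (Suc n)
  then show ?case
    using past_measurable_mono[OF Suc, of "Suc n"] past_W[of "Suc n" "Suc n"] by simp
qed simp

lemma err_past: "err n \<in> borel_measurable (past n)"
proof (induction n)
  case (Suc n)
  then show ?case
    using past_measurable_mono[OF Suc, of "Suc n"] past_W[of "Suc n" "Suc n"] past_Z[of "Suc n" "Suc n"] by simp
qed simp

lemma S_measurable [measurable]: "S n \<in> borel_measurable M"
  and err_measurable [measurable]: "err n \<in> borel_measurable M"
  by (rule past_measurable, rule S_past) (rule past_measurable, rule err_past)

lemma obs_past: "1 \<le> t \<Longrightarrow> t \<le> n \<Longrightarrow> obs t \<in> borel_measurable (past n)"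
proof -
  assume t: "1 \<le> t" "t \<le> n"
  have "err (t - 1) \<in> borel_measurable (past n)" "S (t - 1) \<in> borel_measurable (past n)"
    using past_measurable_mono[OF err_past, of "t - 1" n] past_measurable_mono[OF S_past, of "t - 1" n] t by auto
  then show ?thesis unfolding obs_def[abs_def] Vproc_def Sproc_def
    using past_W[OF t] past_Z[OF t] by simp
qed

lemma outputs_past: "sets (outputs n) \<subseteq> sets (past n)"
  using obs_past by (intro past_sigma_subset) (auto simp: past_sets)

lemma outputs_subalgebra: "subalgebra M (outputs n)"
  using outputs_past[of n] past_subalgebra[of n] by (auto simp: subalgebra_def past_sigma_sets)

lemma outputs_mono: "n \<le> m \<Longrightarrow> sets (outputs n) \<subseteq> sets (outputs m)"
  unfolding past_sigma_sets by (intro sigma_sets_subseteq) fastforce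

lemma obs_Suc:
  "obs (Suc n) \<omega> = (Lam + c - a) * err n \<omega> + Z (Suc n) \<omega> + W (Suc n) \<omega> + (c - a) * est n \<omega>"
  by (simp add: obs_def Vproc_def Sproc_def est_def algebra_simps)

text \<open>The predictor form of the filter. As \<open>est\<close> is defined from state and error,
  neither of which is observed, it is this recursion that makes it a function of the past
  outputs.\<close>

lemma est_Suc: "est (Suc n) \<omega> = c * est n \<omega> + G n * (obs (Suc n) \<omega> - (c - a) * est n \<omega>)"
  unfolding obs_Suc by (simp add: est_def closedF_def algebra_simps)

lemma est_outputs: "est n \<in> borel_measurable (outputs n)"
proof (induction n)
  case 0
  show ?case by (simp add: est_def[abs_def])
next
  case (Suc n)
  have "est n \<in> borel_measurable (outputs (Suc n))"
    using Suc outputs_mono[of n "Suc n"] by (auto simp: measurable_def past_sigma_sets(2))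
  moreover have "obs (Suc n) \<in> borel_measurable (outputs (Suc n))" by (rule past_sigma_measurable) auto
  ultimately show ?case unfolding est_Suc[abs_def] by simp
qed

primrec shift :: "nat \<Rightarrow> nat + nat \<Rightarrow> nat + nat" where
  "shift n (Inl k) = Inl (n + k)"
| "shift n (Inr k) = Inr (n + k)"

text \<open>Index \<open>None\<close> lumps all noises up to time n into one sigma-algebra, while
  \<open>Some i\<close> keeps each noise at times n + 1, ..., n + m separate. The case m = 1 serves
  one filter step, general m a window of length m.\<close>

lemma future_indep:
  "indep_sets (\<lambda>j. case j of None \<Rightarrow> sets (past n)
       | Some i \<Rightarrow> {noise_rv (shift n i) -` A \<inter> space M | A. A \<in> sets borel})
     (insert None (Some ` (Inl ` {1..m} \<union> Inr ` {1..m})))"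
proof -
  let ?E = "\<lambda>i. {noise_rv i -` A \<inter> space M | A. A \<in> sets borel}"
  let ?I = "\<lambda>j. case j of None \<Rightarrow> Inl ` {1..n} \<union> Inr ` {1..n} | Some i \<Rightarrow> {shift n i}"
  let ?J = "insert None (Some ` (Inl ` {1..m} \<union> Inr ` {1..m}))"
  have "indep_sets (\<lambda>j. sigma_sets (space M) (\<Union>i\<in>?I j. ?E i)) ?J"
  proof (rule indep_sets_collect_sigma)
    show "indep_sets ?E (\<Union>j\<in>?J. ?I j)"
      by (rule indep_sets_mono_index[OF _ noise_indep]) auto
    show "Int_stable (?E i)" for i
      by (rule Int_stable_vimage)
    show "disjoint_family_on ?I ?J"
      by (auto simp: disjoint_family_on_def)
  qed
  then show ?thesis
    by (rule indep_sets_mono_sets) (auto simp: past_sets split: option.splits)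
qed

lemma expectation_past_noise:
  fixes f :: "'w \<Rightarrow> complex" and p q :: "real \<Rightarrow> complex"
  assumes f: "f \<in> borel_measurable (past n)" "\<And>\<omega>. norm (f \<omega>) \<le> bf"
    and p: "p \<in> borel_measurable borel" "\<And>x. norm (p x) \<le> bp"
    and q: "q \<in> borel_measurable borel" "\<And>x. norm (q x) \<le> bq"
  shows "expectation (\<lambda>\<omega>. f \<omega> * (p (W (Suc n) \<omega>) * q (Z (Suc n) \<omega>))) =
    expectation f * (expectation (\<lambda>\<omega>. p (W (Suc n) \<omega>)) * expectation (\<lambda>\<omega>. q (Z (Suc n) \<omega>)))"
proof -
  let ?X = "\<lambda>j. case j of None \<Rightarrow> f | Some i \<Rightarrow>
    (case i of Inl t \<Rightarrow> \<lambda>\<omega>. p (W (n + t) \<omega>) | Inr t \<Rightarrow> \<lambda>\<omega>. q (Z (n + t) \<omega>))"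
  let ?I = "{None, Some (Inl 1), Some (Inr 1)} :: (nat + nat) option set"
  have X: "?X j \<in> borel_measurable M" if "j \<in> ?I" for j
    using that past_measurable[OF f(1)] p(1) q(1) by auto
  have "indep_sets (\<lambda>j. case j of None \<Rightarrow> sets (past n) | Some i \<Rightarrow> {noise_rv (shift n i) -` A \<inter> space M | A. A \<in> sets borel}) ?I"
    by (rule indep_sets_mono_index[OF _ future_indep[of n 1]]) auto
  then have "indep_sets (\<lambda>j. {?X j -` A \<inter> space M | A. A \<in> sets borel}) ?I"
  proof (rule indep_sets_mono_sets)
    fix j assume j: "j \<in> ?I"
    have v: "\<exists>B. (\<lambda>\<omega>. g (h \<omega>)) -` A \<inter> space M = h -` B \<inter> space M \<and> B \<in> sets borel"
      if "g \<in> borel_measurable borel" "A \<in> sets borel" for g :: "real \<Rightarrow> complex" and h :: "'w \<Rightarrow> real" and A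
      using measurable_sets[OF that] by (intro exI[of _ "g -` A"]) auto
    show "{?X j -` A \<inter> space M | A. A \<in> sets borel} \<subseteq>
      (case j of None \<Rightarrow> sets (past n) | Some i \<Rightarrow> {noise_rv (shift n i) -` A \<inter> space M | A. A \<in> sets borel})"
      using j measurable_sets[OF f(1)] v[OF p(1)] v[OF q(1)] by (auto simp: past_sets(2))
  qed
  then have "indep_vars (\<lambda>_. borel) ?X ?I" unfolding indep_vars_def2 using X by blast
  moreover have "integrable M (?X j)" if "j \<in> ?I" for j
    by (rule integrable_bounded[OF X[OF that], of "max bf (max bp bq)"])
      (use that f(2) p(2) q(2) in \<open>auto simp: le_max_iff_disj\<close>)
  ultimately have "expectation (\<lambda>\<omega>. \<Prod>j\<in>?I. ?X j \<omega>) = (\<Prod>j\<in>?I. expectation (?X j))"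
    by (intro indep_vars_lebesgue_integral) auto
  then show ?thesis by simp
qed

lemma expectation_iexp_W: "expectation (\<lambda>\<omega>. iexp (u * W (Suc n) \<omega>)) = gchar KW u"
  and expectation_iexp_Z: "expectation (\<lambda>\<omega>. iexp (u * Z (Suc n) \<omega>)) = gchar KZ u"
  using expectation_iexp_distr[OF W_distr, of "Suc n" u] expectation_iexp_distr[OF Z_distr, of "Suc n" u] KW KZ
  by (simp_all add: char_gauss)

text \<open>Independence of the filtering error from the past outputs; this is what makes est the
  conditional expectation.\<close>
definition filter_inv :: "nat \<Rightarrow> bool" where
  "filter_inv n \<longleftrightarrow>
    indep_set (sets (outputs n)) {err n -` B \<inter> space M | B. B \<in> sets borel} \<and>
    (\<forall>v. expectation (\<lambda>\<omega>. iexp (v * err n \<omega>)) = gchar (K n) v)"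

lemma filter_inv_expectation:
  fixes f :: "'w \<Rightarrow> complex"
  assumes inv: "filter_inv n" and f: "f \<in> borel_measurable (outputs n)" "\<And>\<omega>. norm (f \<omega>) \<le> b"
  shows "expectation (\<lambda>\<omega>. f \<omega> * iexp (v * err n \<omega>)) = expectation f * gchar (K n) v"
proof -
  have "indep_var borel f borel (\<lambda>\<omega>. iexp (v * err n \<omega>))"
    using inv unfolding filter_inv_def
    by (intro indep_var_from_set[OF _ outputs_subalgebra f(1) err_measurable]) auto
  moreover have "f \<in> borel_measurable M" using measurable_from_subalg[OF outputs_subalgebra f(1)] .
  ultimately have "expectation (\<lambda>\<omega>. f \<omega> * iexp (v * err n \<omega>)) = expectation f * expectation (\<lambda>\<omega>. iexp (v * err n \<omega>))"
    by (intro indep_var_lebesgue_integral integrable_bounded[of f, OF _ f(2)] integrable_bounded[of _ 1]) auto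
  then show ?thesis using inv by (simp add: filter_inv_def)
qed

text \<open>The joint exponent yields a quadratic form in u and v. Its mixed term is the correlation
  of next error and innovation, cancelled by \<open>gainM_orthogonal\<close>; its v-part is the
  Joseph form of \<open>K (Suc n)\<close>. Hence the dependence on v splits off as a factor.\<close>

lemma filter_inv_step_expectation:
  fixes f :: "'w \<Rightarrow> complex"
  assumes inv: "filter_inv n" and f: "f \<in> borel_measurable (outputs n)" "\<And>\<omega>. norm (f \<omega>) \<le> b"
  shows "expectation (\<lambda>\<omega>. f \<omega> * (iexp (v * err (Suc n) \<omega>) * iexp (u * obs (Suc n) \<omega>))) =
    expectation (\<lambda>\<omega>. f \<omega> * iexp (u * obs (Suc n) \<omega>)) * gchar (K (Suc n)) v"
proof -
  let ?C = "Lam + c - a"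
  \<comment> \<open>The part of the next output that is known from the past,
    \<open>(c - a) * est n\<close>, is absorbed into the test function, leaving the
    innovation.\<close>
  define g where "g = (\<lambda>\<omega>. f \<omega> * iexp (u * (c - a) * est n \<omega>))"
  have g: "g \<in> borel_measurable (outputs n)" "norm (g \<omega>) \<le> b" for \<omega>
    unfolding g_def using f est_outputs[of n] by (auto simp: norm_mult)
  have gp: "g \<in> borel_measurable (past n)"
    using g(1) outputs_past[of n] by (auto simp: measurable_def past_sigma_sets(2) past_sets(2))
  have main: "expectation (\<lambda>\<omega>. f \<omega> * (iexp (v * err (Suc n) \<omega>) * iexp (u * obs (Suc n) \<omega>))) =
    expectation g * (gchar (K (Suc n)) v * gchar (?C\<^sup>2 * K n + KZ + KW) u)" for v
  proof -
    have "f \<omega> * (iexp (v * err (Suc n) \<omega>) * iexp (u * obs (Suc n) \<omega>)) =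
        (g \<omega> * iexp ((v * F n + u * ?C) * err n \<omega>)) *
        (iexp ((v * (1 - G n) + u) * W (Suc n) \<omega>) * iexp ((u - v * G n) * Z (Suc n) \<omega>))" for \<omega>
    proof -
      have "v * err (Suc n) \<omega> + u * obs (Suc n) \<omega> =
        u * (c - a) * est n \<omega> + ((v * F n + u * ?C) * err n \<omega> +
        ((v * (1 - G n) + u) * W (Suc n) \<omega> + (u - v * G n) * Z (Suc n) \<omega>))"
        by (simp add: obs_Suc algebra_simps)
      then have "iexp (v * err (Suc n) \<omega>) * iexp (u * obs (Suc n) \<omega>) =
        iexp (u * (c - a) * est n \<omega>) * (iexp ((v * F n + u * ?C) * err n \<omega>) *
        (iexp ((v * (1 - G n) + u) * W (Suc n) \<omega>) * iexp ((u - v * G n) * Z (Suc n) \<omega>)))"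
        by (simp only: iexp_add[symmetric])
      then show ?thesis by (simp only: g_def mult.assoc)
    qed
    then have "expectation (\<lambda>\<omega>. f \<omega> * (iexp (v * err (Suc n) \<omega>) * iexp (u * obs (Suc n) \<omega>))) =
      expectation (\<lambda>\<omega>. (g \<omega> * iexp ((v * F n + u * ?C) * err n \<omega>)) *
        (iexp ((v * (1 - G n) + u) * W (Suc n) \<omega>) * iexp ((u - v * G n) * Z (Suc n) \<omega>)))"
      by (simp only:)
    also have "\<dots> = expectation (\<lambda>\<omega>. g \<omega> * iexp ((v * F n + u * ?C) * err n \<omega>)) *
       (expectation (\<lambda>\<omega>. iexp ((v * (1 - G n) + u) * W (Suc n) \<omega>)) * expectation (\<lambda>\<omega>. iexp ((u - v * G n) * Z (Suc n) \<omega>)))"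
      by (rule expectation_past_noise[where p = "\<lambda>x. iexp ((v * (1 - G n) + u) * x)" and q = "\<lambda>x. iexp ((u - v * G n) * x)"
            and bf = b and bp = 1 and bq = 1])
        (use gp g(2) err_past[of n] in \<open>auto simp: norm_mult\<close>)
    also have "\<dots> = expectation g * (gchar (K n) (v * F n + u * ?C) * (gchar KW (v * (1 - G n) + u) * gchar KZ (u - v * G n)))"
      by (simp only: filter_inv_expectation[OF inv g] expectation_iexp_W expectation_iexp_Z mult.assoc)
    also have "gchar (K n) (v * F n + u * ?C) * (gchar KW (v * (1 - G n) + u) * gchar KZ (u - v * G n))
       = gchar (K (Suc n)) v * gchar (?C\<^sup>2 * K n + KZ + KW) u"
    proof -
      have o: "F n * ?C * K n + (1 - G n) * KW - G n * KZ = 0"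
        by (rule gainM_orthogonal[OF KW KZ K_nonneg])
      have j: "K (Suc n) = (F n)\<^sup>2 * K n + (1 - G n)\<^sup>2 * KW + (G n)\<^sup>2 * KZ"
        using ric_joseph[OF KW KZ K_nonneg] by simp
      have "K n * (v * F n + u * ?C)\<^sup>2 + (KW * (v * (1 - G n) + u)\<^sup>2 + KZ * (u - v * G n)\<^sup>2)
        = ((F n)\<^sup>2 * K n + (1 - G n)\<^sup>2 * KW + (G n)\<^sup>2 * KZ) * v\<^sup>2 + (?C\<^sup>2 * K n + KZ + KW) * u\<^sup>2
          + 2 * u * v * (F n * ?C * K n + (1 - G n) * KW - G n * KZ)"
        by (simp add: power2_eq_square algebra_simps)
      also have "\<dots> = K (Suc n) * v\<^sup>2 + (?C\<^sup>2 * K n + KZ + KW) * u\<^sup>2"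
        unfolding o j by simp
      finally show ?thesis
        by (simp add: gchar_def del: Kop.simps flip: of_real_mult exp_add add_divide_distrib)
    qed
    finally show ?thesis .
  qed
  \<comment> \<open>At v = 0 the formula identifies the remaining factor as the transform of
    \<open>f\<close> against the output.\<close>
  show ?thesis using main[of v] main[of 0] by (simp add: gchar_def)
qed

end

context noisy_channel
begin

text \<open>The step formula factorises transforms only. Inverting it in u, with an event of the
  earlier outputs fixed, and afterwards in v gives the product rule on an intersection-stable
  generator of the enlarged output sigma-algebra.\<close>

lemma filter_inv: "filter_inv n"
proof (induction n)
  case 0
  have "indep_set (sets (outputs 0)) {err 0 -` B \<inter> space M | B. B \<in> sets borel}"
  proof (rule indep_setI)
    show "sets (outputs 0) \<subseteq> events" using outputs_subalgebra[of 0] by (simp add: subalgebra_def)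
    show "{err 0 -` B \<inter> space M | B. B \<in> sets borel} \<subseteq> events" by (auto intro: measurable_sets[OF err_measurable])
    fix A E assume A: "A \<in> sets (outputs 0)" and "E \<in> {err 0 -` B \<inter> space M | B. B \<in> sets borel}"
    then have "E = {} \<or> E = space M" by (auto split: if_splits)
    moreover have "A \<subseteq> space M" using sets.sets_into_space[OF A] by (simp add: past_sigma_sets)
    ultimately show "prob (A \<inter> E) = prob A * prob E"
      by (auto simp: prob_space Int_absorb2)
  qed
  then show ?case by (simp add: filter_inv_def gchar_def prob_space)
next
  case (Suc n)
  let ?e = "err (Suc n)" and ?y = "obs (Suc n)" and ?\<phi> = "gchar (K (Suc n))"
  have e [measurable]: "?e \<in> borel_measurable M" by (rule err_measurable)
  have y [measurable]: "?y \<in> borel_measurable M"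
    using obs_past[of "Suc n" "Suc n"] past_measurable by auto
  have n\<phi>: "norm (?\<phi> v) \<le> 1" for v using K_nonneg[of "Suc n"] by (simp add: gchar_def del: Kop.simps)
  have out: "A \<in> events" if "A \<in> sets (outputs n)" for A
    using that outputs_subalgebra[of n] by (auto simp: subalgebra_def)
  have char: "expectation (\<lambda>\<omega>. complex_of_real (indicator (A \<inter> (?y -` B \<inter> space M)) \<omega>) * iexp (v * ?e \<omega>)) =
      complex_of_real (prob (A \<inter> (?y -` B \<inter> space M))) * ?\<phi> v"
    if A: "A \<in> sets (outputs n)" and B: "B \<in> sets borel" for A B v
  proof -
    note [measurable] = out[OF A] B
    let ?i = "\<lambda>\<omega>. indicator A \<omega> :: complex"
    \<comment> \<open>By the step formula the transform of this function against the output vanishes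
      for every u, so the exponential of the output may be replaced by an indicator
      \<open>B\<close>.\<close>
    let ?h = "\<lambda>\<omega>. ?i \<omega> * (iexp (v * ?e \<omega>) - ?\<phi> v)"
    let ?E = "A \<inter> (?y -` B \<inter> space M)"
    have E: "?E \<in> events" using measurable_sets[OF y B] out[OF A] by auto
    have "norm (iexp (v * ?e \<omega>) - ?\<phi> v) \<le> 2" for \<omega>
      using norm_triangle_ineq4[of "iexp (v * ?e \<omega>)" "?\<phi> v"] n\<phi>[of v] by (simp del: err.simps Kop.simps)
    then have hb: "norm (?h \<omega>) \<le> 2" for \<omega>
      by (simp add: norm_mult indicator_def del: err.simps Kop.simps)
    have "expectation (\<lambda>\<omega>. ?h \<omega> * iexp (u * ?y \<omega>)) = 0" for u
    proof -
      have "expectation (\<lambda>\<omega>. ?h \<omega> * iexp (u * ?y \<omega>)) =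
        expectation (\<lambda>\<omega>. ?i \<omega> * (iexp (v * ?e \<omega>) * iexp (u * ?y \<omega>)) - (?i \<omega> * iexp (u * ?y \<omega>)) * ?\<phi> v)"
        by (simp add: algebra_simps del: err.simps Kop.simps)
      also have "\<dots> = expectation (\<lambda>\<omega>. ?i \<omega> * (iexp (v * ?e \<omega>) * iexp (u * ?y \<omega>)))
          - expectation (\<lambda>\<omega>. (?i \<omega> * iexp (u * ?y \<omega>)) * ?\<phi> v)"
        using n\<phi>[of v] by (intro Bochner_Integration.integral_diff integrable_bounded[of _ 1])
          (auto simp: norm_mult indicator_def simp del: err.simps Kop.simps)
      also have "\<dots> = 0"
        using filter_inv_step_expectation[OF Suc, of ?i 1 v u] A
        by (simp add: indicator_def del: err.simps Kop.simps)
      finally show ?thesis .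
    qed
    then have "expectation (\<lambda>\<omega>. ?h \<omega> * indicator B (?y \<omega>)) = 0"
      by (intro fourier_null_imp_null[OF _ y hb _ B]) auto
    also have "expectation (\<lambda>\<omega>. ?h \<omega> * indicator B (?y \<omega>)) =
      expectation (\<lambda>\<omega>. complex_of_real (indicator ?E \<omega>) * iexp (v * ?e \<omega>) - complex_of_real (indicator ?E \<omega>) * ?\<phi> v)"
      by (intro Bochner_Integration.integral_cong) (auto simp: indicator_def simp del: err.simps Kop.simps)
    also have "\<dots> = expectation (\<lambda>\<omega>. complex_of_real (indicator ?E \<omega>) * iexp (v * ?e \<omega>))
        - expectation (\<lambda>\<omega>. complex_of_real (indicator ?E \<omega>) * ?\<phi> v)"
      using n\<phi>[of v] E by (intro Bochner_Integration.integral_diff integrable_bounded[of _ 1])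
        (auto simp: norm_mult indicator_def simp del: err.simps Kop.simps)
    also have "expectation (\<lambda>\<omega>. complex_of_real (indicator ?E \<omega>) * ?\<phi> v) = complex_of_real (prob ?E) * ?\<phi> v"
      using E by (simp add: integral_complex_of_real del: of_real_indicator err.simps Kop.simps)
    finally show ?thesis by simp
  qed
  have char_e: "expectation (\<lambda>\<omega>. iexp (v * ?e \<omega>)) = ?\<phi> v" for v
  proof -
    have "space M \<in> sets (outputs n)" using sets.top[of "outputs n"] by (simp add: past_sigma_sets)
    \<comment> \<open>Taking the whole space and \<open>UNIV\<close> as events leaves the law of the
      error alone.\<close>
    from char[OF this, of UNIV v] have "expectation (\<lambda>\<omega>. complex_of_real (indicator (space M) \<omega>) * iexp (v * ?e \<omega>)) = ?\<phi> v"
      by (simp add: prob_space del: err.simps Kop.simps)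
    then show ?thesis by (simp cong: Bochner_Integration.integral_cong del: err.simps Kop.simps)
  qed
  let ?P = "{A \<inter> (?y -` B \<inter> space M) | A B. A \<in> sets (outputs n) \<and> B \<in> sets borel}"
  let ?Q = "{?e -` D \<inter> space M | D. D \<in> sets borel}"
  have "indep_set ?P ?Q"
  proof (rule indep_setI)
    show "?P \<subseteq> events" using out measurable_sets[OF y] by blast
    show "?Q \<subseteq> events" using measurable_sets[OF e] by blast
    fix P Q assume "P \<in> ?P" "Q \<in> ?Q"
    then obtain A B D where A: "A \<in> sets (outputs n)" and B: "B \<in> sets borel" and D: "D \<in> sets borel"
      and P: "P = A \<inter> (?y -` B \<inter> space M)" and Q: "Q = ?e -` D \<inter> space M" by blast
    have E [measurable]: "P \<in> events" "Q \<in> events"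
      using out[OF A] measurable_sets[OF y B] measurable_sets[OF e D] P Q by auto
    \<comment> \<open>Inversion in v: the centred indicator of \<open>P\<close> integrates to zero
      against every exponential of the error.\<close>
    have zero: "expectation (\<lambda>\<omega>. complex_of_real (indicator P \<omega> - prob P) * iexp (v * ?e \<omega>)) = 0" for v
    proof -
      have "expectation (\<lambda>\<omega>. complex_of_real (indicator P \<omega> - prob P) * iexp (v * ?e \<omega>)) =
        expectation (\<lambda>\<omega>. complex_of_real (indicator P \<omega>) * iexp (v * ?e \<omega>)) -
        expectation (\<lambda>\<omega>. complex_of_real (prob P) * iexp (v * ?e \<omega>))"
        unfolding of_real_diff left_diff_distrib
        by (intro Bochner_Integration.integral_diff integrable_bounded[of _ 1])
          (auto simp: norm_mult indicator_def simp del: err.simps)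
      then show ?thesis using char[OF A B, of v] char_e[of v] unfolding P
        by (simp del: err.simps Kop.simps of_real_indicator)
    qed
    have "expectation (\<lambda>\<omega>. (indicator P \<omega> - prob P) * indicator D (?e \<omega>)) = 0"
    proof (rule fourier_null_imp_null_real[OF _ e _ zero D])
      show "\<bar>indicator P \<omega> - prob P\<bar> \<le> 1" for \<omega>
        using prob_le_1[of P] measure_nonneg[of M P] by (auto simp: indicator_def)
    qed simp
    also have "expectation (\<lambda>\<omega>. (indicator P \<omega> - prob P) * indicator D (?e \<omega>)) =
      expectation (\<lambda>\<omega>. indicator (P \<inter> Q) \<omega> - prob P * indicator Q \<omega>)"
      by (intro Bochner_Integration.integral_cong) (auto simp: indicator_def Q)
    also have "\<dots> = expectation (indicator (P \<inter> Q)) - expectation (\<lambda>\<omega>. prob P * indicator Q \<omega>)"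
      by (intro Bochner_Integration.integral_diff integrable_bounded[of _ 1])
        (auto simp: indicator_def)
    also have "\<dots> = prob (P \<inter> Q) - prob P * prob Q" by simp
    finally show "prob (P \<inter> Q) = prob P * prob Q" by simp
  qed
  moreover have "Int_stable ?P"
  proof (rule Int_stableI)
    fix P P' assume "P \<in> ?P" "P' \<in> ?P"
    then obtain A B A' B' where *: "A \<in> sets (outputs n)" "B \<in> sets borel" "P = A \<inter> (?y -` B \<inter> space M)"
      "A' \<in> sets (outputs n)" "B' \<in> sets borel" "P' = A' \<inter> (?y -` B' \<inter> space M)" by blast
    then have "P \<inter> P' = (A \<inter> A') \<inter> (?y -` (B \<inter> B') \<inter> space M)" by auto
    then show "P \<inter> P' \<in> ?P" using * sets.Int by blast
  qed
  ultimately have ind: "indep_set (sigma_sets (space M) ?P) (sigma_sets (space M) ?Q)"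
    using Int_stable_vimage by (rule indep_set_sigma_sets)
  \<comment> \<open>Earlier outputs are reached with \<open>B = UNIV\<close>, the new one with
    \<open>A = space M\<close>.\<close>
  have "sets (outputs (Suc n)) \<subseteq> sigma_sets (space M) ?P"
    unfolding past_sigma_sets(1)[of M obs "Suc (Suc n)"]
  proof (rule sigma_sets_mono, safe)
    fix i B assume i: "1 \<le> i" "i < Suc (Suc n)" and B: "B \<in> sets (borel :: real measure)"
    show "obs i -` B \<inter> space M \<in> sigma_sets (space M) ?P"
    proof (cases "i = Suc n")
      case True
      have "space M \<in> sets (outputs n)" using sets.top[of "outputs n"] by (simp add: past_sigma_sets)
      moreover have "obs i -` B \<inter> space M = space M \<inter> (?y -` B \<inter> space M)" using True by auto
      ultimately show ?thesis using B by (intro sigma_sets.Basic) blast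
    next
      case False
      then have "obs i -` B \<inter> space M \<in> sets (outputs n)"
        using i B unfolding past_sigma_sets(1)
        by (intro sigma_sets.Basic CollectI exI[of _ i] exI[of _ B]) auto
      then show ?thesis
        by (intro sigma_sets.Basic CollectI exI[of _ "obs i -` B \<inter> space M"] exI[of _ UNIV]) auto
    qed
  qed
  moreover have "?Q \<subseteq> sigma_sets (space M) ?Q" by auto
  ultimately have "indep_set (sets (outputs (Suc n))) ?Q"
    using ind unfolding indep_set_def
    by (elim indep_sets_mono_sets) (auto split: bool.splits)
  then show ?case using char_e by (simp add: filter_inv_def del: err.simps Kop.simps)
qed

section \<open>The linear estimate is the conditional expectation\<close>

lemma W_mean: "integrable M (W (Suc n))" "expectation (W (Suc n)) = 0"
  and Z_mean: "integrable M (Z (Suc n))" "expectation (Z (Suc n)) = 0"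
proof -
  have id: "(\<lambda>x::real. x) \<in> borel_measurable borel" by simp
  have *: "integrable M X" "expectation X = 0" if "X \<in> borel_measurable M" "distr M borel X = gauss 0 v" for X v
    using gauss_mean_zero[of v] integrable_distr_eq[OF that(1) id] integral_distr[OF that(1) id]
    unfolding that(2) by (simp_all only:)
  show "integrable M (W (Suc n))" "expectation (W (Suc n)) = 0"
    by (rule *[OF W_distr], simp, simp)+
  show "integrable M (Z (Suc n))" "expectation (Z (Suc n)) = 0"
    by (rule *[OF Z_distr], simp, simp)+
qed

lemma err_mean: "integrable M (err n)" "expectation (err n) = 0"
proof -
  have "integrable M (err n) \<and> expectation (err n) = 0"
    by (induction n) (auto simp: W_mean Z_mean)
  then show "integrable M (err n)" "expectation (err n) = 0" by auto
qed

lemma S_integrable: "integrable M (S n)"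
  by (induction n) (auto simp: W_mean)

text \<open>The recursion \<open>est_Suc\<close> run on an arbitrary output sequence. On outputs
  equal to \<open>obs\<close> almost everywhere it gives a version of \<open>est n\<close> that is
  measurable for the sigma-algebra of those very outputs, which \<open>est n\<close> itself need not
  be.\<close>

primrec filt :: "(nat \<Rightarrow> 'w \<Rightarrow> real) \<Rightarrow> nat \<Rightarrow> 'w \<Rightarrow> real" where
  "filt Y 0 = (\<lambda>_. s)"
| "filt Y (Suc n) = (\<lambda>\<omega>. c * filt Y n \<omega> + G n * (Y (Suc n) \<omega> - (c - a) * filt Y n \<omega>))"

lemma filt_measurable:
  assumes "\<And>i. 1 \<le> i \<Longrightarrow> i \<le> n \<Longrightarrow> Y i \<in> borel_measurable N"
  shows "filt Y n \<in> borel_measurable N"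
  using assms by (induction n) auto

lemma filt_AE:
  assumes "\<And>i. 1 \<le> i \<Longrightarrow> i \<le> n \<Longrightarrow> AE \<omega> in M. Y i \<omega> = obs i \<omega>"
  shows "AE \<omega> in M. filt Y n \<omega> = est n \<omega>"
  using assms
proof (induction n)
  case 0
  then show ?case by (simp add: est_def)
next
  case (Suc n)
  have "AE \<omega> in M. filt Y n \<omega> = est n \<omega>" "AE \<omega> in M. Y (Suc n) \<omega> = obs (Suc n) \<omega>"
    using Suc by auto
  then show ?case by eventually_elim (simp add: est_Suc)
qed

text \<open>An event in the past of \<open>Y\<close> is exchanged for its version in
  \<open>outputs n\<close>; there the error, being independent and of mean zero, integrates to zero,
  so state and estimate have equal integrals.\<close>

lemma cond_exp_outputs:
  assumes Y: "\<And>i. 1 \<le> i \<Longrightarrow> i \<le> n \<Longrightarrow> Y i \<in> borel_measurable M"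
    and AE: "\<And>i. 1 \<le> i \<Longrightarrow> i \<le> n \<Longrightarrow> AE \<omega> in M. Y i \<omega> = obs i \<omega>"
  shows "AE \<omega> in M. real_cond_exp M (past_sigma M Y (Suc n)) (S n) \<omega> = est n \<omega>"
proof -
  let ?F = "past_sigma M Y (Suc n)"
  have sub: "subalgebra M ?F" unfolding subalgebra_def
    using past_sigma_subset[of M M "Suc n" Y] Y by (auto simp: past_sigma_sets(2))
  interpret finite_measure_subalgebra M ?F by standard (rule sub)
  have fm: "filt Y n \<in> borel_measurable ?F"
    by (rule filt_measurable) (auto intro: past_sigma_measurable)
  note [measurable] = measurable_from_subalg[OF sub fm]
  have est_m [measurable]: "est n \<in> borel_measurable M"
    unfolding est_def[abs_def] by simp
  have est_i: "integrable M (est n)"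
    unfolding est_def[abs_def] using S_integrable err_mean by auto
  have fe: "AE \<omega> in M. filt Y n \<omega> = est n \<omega>" by (rule filt_AE[OF AE])
  then have fi: "integrable M (filt Y n)"
    using est_i by (subst integrable_cong_AE) auto
  have "AE \<omega> in M. real_cond_exp M ?F (S n) \<omega> = filt Y n \<omega>"
  proof (rule real_cond_exp_charact[OF _ S_integrable fi fm])
    fix A assume A: "A \<in> sets ?F"
    have AM [measurable]: "A \<in> events" using A sub by (auto simp: subalgebra_def)
    obtain A' where A': "A' \<in> sets (outputs n)" and AA: "AE \<omega> in M. \<omega> \<in> A \<longleftrightarrow> \<omega> \<in> A'"
      using past_sigma_AE_version[OF _ A, of obs] AE by (auto simp: less_Suc_eq_le)
    have A'M [measurable]: "A' \<in> events" using A' outputs_subalgebra[of n] by (auto simp: subalgebra_def)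
    have "indep_var borel (indicator A' :: _ \<Rightarrow> real) borel (\<lambda>\<omega>. err n \<omega>)"
      using filter_inv[of n] A' unfolding filter_inv_def
      by (intro indep_var_from_set[OF _ outputs_subalgebra _ err_measurable, where g = "\<lambda>x. x"]) auto
    from indep_var_lebesgue_integral[OF this]
    have orth: "(\<integral>\<omega>. indicator A' \<omega> * err n \<omega> \<partial>M) = 0"
      using err_mean by (simp add: integrable_bounded[of "indicator A'", where b = 1] indicator_def)
    have ii: "integrable M (\<lambda>\<omega>. indicator A' \<omega> * g \<omega>)" if "integrable M g" for g :: "'w \<Rightarrow> real"
      using integrable_mult_indicator[OF A'M that] by simp
    have "(\<integral>\<omega>\<in>A. S n \<omega> \<partial>M) = (\<integral>\<omega>. indicator A' \<omega> * est n \<omega> + indicator A' \<omega> * err n \<omega> \<partial>M)"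
      unfolding set_lebesgue_integral_def
      by (rule integral_cong_AE) (use AA in \<open>auto simp: est_def indicator_def\<close>)
    also have "\<dots> = (\<integral>\<omega>. indicator A' \<omega> * est n \<omega> \<partial>M)"
      using orth ii[OF est_i] ii[OF err_mean(1)] by simp
    also have "\<dots> = (\<integral>\<omega>\<in>A. filt Y n \<omega> \<partial>M)"
      unfolding set_lebesgue_integral_def
      by (rule integral_cong_AE) (use AA fe in \<open>auto simp: indicator_def\<close>)
    finally show "(\<integral>\<omega>\<in>A. S n \<omega> \<partial>M) = (\<integral>\<omega>\<in>A. filt Y n \<omega> \<partial>M)" .
  qed
  with fe show ?thesis by auto
qed

text \<open>The conditional expectation entering a new output involves only earlier outputs, to
  which the induction hypothesis applies. The separate clause for the first input agrees with the
  general form because \<open>err 0\<close> is zero.\<close>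

lemma Yh_obs:
  assumes "1 \<le> i" "i \<le> n"
  shows "Yh M a c Lam s W Z n i \<in> borel_measurable M"
    and "AE \<omega> in M. Yh M a c Lam s W Z n i \<omega> = obs i \<omega>"
proof -
  have "Yh M a c Lam s W Z n i \<in> borel_measurable M \<and> (AE \<omega> in M. Yh M a c Lam s W Z n i \<omega> = obs i \<omega>)"
    using assms
  proof (induction n arbitrary: i)
    case (Suc n)
    show ?case
    proof (cases "i = Suc n")
      case False
      then show ?thesis using Suc by simp
    next
      case True
      let ?E = "real_cond_exp M (past_sigma M (Yh M a c Lam s W Z n) (Suc n)) (S n)"
      have E: "AE \<omega> in M. ?E \<omega> = est n \<omega>"
        using Suc.IH by (intro cond_exp_outputs) auto
      have Em [measurable]: "?E \<in> borel_measurable M" by (rule borel_measurable_cond_exp2)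
      have Y: "Yh M a c Lam s W Z (Suc n) i = (\<lambda>\<omega>. (if n = 0 then Z 1 \<omega> else Lam * (S n \<omega> - ?E \<omega>) + Z (Suc n) \<omega>)
        + ((c - a) * S n \<omega> + W (Suc n) \<omega>))"
        using True by (simp add: Vproc_def Sproc_def fun_eq_iff)
      have "AE \<omega> in M. Yh M a c Lam s W Z (Suc n) i \<omega> = obs i \<omega>"
        using E unfolding Y by eventually_elim
          (auto simp: True obs_def Vproc_def Sproc_def est_def)
      moreover have "Yh M a c Lam s W Z (Suc n) i \<in> borel_measurable M"
        unfolding Y by (cases "n = 0") auto
      ultimately show ?thesis by blast
    qed
  qed simp
  then show "Yh M a c Lam s W Z n i \<in> borel_measurable M"
    "AE \<omega> in M. Yh M a c Lam s W Z n i \<omega> = obs i \<omega>" by auto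
qed

lemma Yproc_AE:
  assumes "t \<ge> 1"
  shows "Yproc M a c Lam s W Z t \<in> borel_measurable M"
    and "AE \<omega> in M. Yproc M a c Lam s W Z t \<omega> = obs t \<omega>"
  using Yh_obs[OF assms order_refl] by (auto simp: Yproc_def)

lemma Shat_AE: "AE \<omega> in M. Shat M a c Lam s W Z (Suc n) \<omega> = est n \<omega>"
  using cond_exp_outputs[of n "Yproc M a c Lam s W Z"] Yproc_AE
  by (simp add: Shat_def Sproc_def)

lemma Shat_measurable: "Shat M a c Lam s W Z (Suc n) \<in> borel_measurable M"
  unfolding Shat_def by (rule borel_measurable_cond_exp2)

lemma Xproc_AE: "AE \<omega> in M. Xproc M a c Lam s W Z (Suc n) \<omega> = Lam * err n \<omega> + Z (Suc n) \<omega>"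
  using Shat_AE[of n] by eventually_elim (auto simp: Xproc_def Sproc_def est_def)

text \<open>The estimate cancels from the innovation, so only the error and the current noises
  remain.\<close>

lemma Iproc_AE:
  "AE \<omega> in M. Iproc M a c Lam s W Z (Suc n) \<omega> = (Lam + c - a) * err n \<omega> + W (Suc n) \<omega> + Z (Suc n) \<omega>"
proof -
  have "AE \<omega> in M. Yproc M a c Lam s W Z (Suc n) \<omega> = obs (Suc n) \<omega>" by (rule Yproc_AE(2)) simp
  with Shat_AE[of n] show ?thesis by eventually_elim (simp add: Iproc_def obs_Suc)
qed

end

section \<open>Asymptotic stationarity\<close>

text \<open>Points of the product over I equal \<open>undefined\<close> outside I, whereas f is
  continuous on the full function space. The inclusion into the product over all indices is
  measurable, and there product and Borel sigma-algebra agree by countability.\<close>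

lemma continuous_on_fun_borel_measurable_PiM:
  fixes f :: "('i::countable \<Rightarrow> real) \<Rightarrow> real"
  assumes "continuous_on UNIV f"
  shows "f \<in> borel_measurable (PiM I (\<lambda>_. borel))"
proof -
  have "(\<lambda>x. x) \<in> measurable (PiM I (\<lambda>_. borel :: real measure)) (PiM UNIV (\<lambda>_. borel))"
  proof (rule measurable_PiM_single')
    fix p :: 'i
    show "(\<lambda>x. x p) \<in> borel_measurable (PiM I (\<lambda>_. borel :: real measure))"
    proof (cases "p \<in> I")
      case False
      have "(\<lambda>x. x p) \<in> borel_measurable (PiM I (\<lambda>_. borel :: real measure)) \<longleftrightarrow>
        (\<lambda>_. undefined :: real) \<in> borel_measurable (PiM I (\<lambda>_. borel :: real measure))"
        using False by (intro measurable_cong) (auto simp: space_PiM PiE_iff extensional_def)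
      then show ?thesis by simp
    qed simp
  qed (auto simp: space_PiM)
  moreover have "f \<in> borel_measurable (PiM UNIV (\<lambda>_. borel))"
    using borel_measurable_continuous_onI[OF assms] sets_PiM_equal_borel measurable_cong_sets by blast
  ultimately show ?thesis by (rule measurable_compose)
qed

lemma tendsto_fun:
  fixes f :: "'x \<Rightarrow> 'i \<Rightarrow> 'b::topological_space"
  assumes "\<And>i. ((\<lambda>x. f x i) \<longlongrightarrow> l i) F"
  shows "(f \<longlongrightarrow> l) F"
proof -
  have "limitin (product_topology (\<lambda>i. euclidean) UNIV) f l F"
    unfolding limitin_componentwise using assms by simp
  then show ?thesis by (simp add: euclidean_product_topology)
qed

text \<open>The limit law is the law of the pointwise limit \<open>L\<close>, by continuity of f and
  dominated convergence. The formula for \<open>E\<close> is required from time 1 on, where the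
  processes start.\<close>

lemma limit_law_exists:
  fixes H :: "nat \<Rightarrow> 'x \<Rightarrow> 'i::countable \<Rightarrow> real"
  assumes N: "prob_space N"
    and m: "\<And>n p. p \<in> I \<Longrightarrow> (\<lambda>x. H n x p) \<in> borel_measurable N"
    and lim: "\<And>x p. x \<in> space N \<Longrightarrow> p \<in> I \<Longrightarrow> (\<lambda>n. H n x p) \<longlonglongrightarrow> L x p"
    and law: "\<And>n f. continuous_on UNIV f \<Longrightarrow> bounded (range f) \<Longrightarrow>
      E (Suc n) f = (\<integral>x. f (restrict (H n x) I) \<partial>N)"
  shows "\<exists>\<nu>. prob_space \<nu> \<and> sets \<nu> = sets (PiM I (\<lambda>_. borel)) \<and>
    (\<forall>f :: ('i \<Rightarrow> real) \<Rightarrow> real. continuous_on UNIV f \<and> bounded (range f) \<longrightarrow>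
      (\<lambda>t. E t f) \<longlonglongrightarrow> (\<integral>x. f x \<partial>\<nu>))"
proof -
  interpret N: prob_space N by fact
  have Lm: "(\<lambda>x. L x p) \<in> borel_measurable N" if "p \<in> I" for p
    using lim[OF _ that] m[OF that] by (rule borel_measurable_LIMSEQ_real)
  have rm: "(\<lambda>x. restrict (g x) I) \<in> measurable N (PiM I (\<lambda>_. borel))"
    if "\<And>p. p \<in> I \<Longrightarrow> (\<lambda>x. g x p) \<in> borel_measurable N" for g :: "'x \<Rightarrow> 'i \<Rightarrow> real"
    using that by (intro measurable_restrict)
  define \<nu> where "\<nu> = distr N (PiM I (\<lambda>_. borel)) (\<lambda>x. restrict (L x) I)"
  show ?thesis
  proof (intro exI[of _ \<nu>] conjI allI impI)
    show "prob_space \<nu>" unfolding \<nu>_def by (rule N.prob_space_distr[OF rm[OF Lm]])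
    show "sets \<nu> = sets (PiM I (\<lambda>_. borel))" by (simp add: \<nu>_def)
    fix f :: "('i \<Rightarrow> real) \<Rightarrow> real" assume f: "continuous_on UNIV f \<and> bounded (range f)"
    have fm: "f \<in> borel_measurable (PiM I (\<lambda>_. borel))"
      using f by (intro continuous_on_fun_borel_measurable_PiM) auto
    obtain b where b: "\<And>x. norm (f x) \<le> b" using f by (auto simp: bounded_iff)
    have "(\<lambda>n. \<integral>x. f (restrict (H n x) I) \<partial>N) \<longlonglongrightarrow> (\<integral>x. f (restrict (L x) I) \<partial>N)"
    proof (rule integral_dominated_convergence[where w = "\<lambda>_. b"])
      show "AE x in N. (\<lambda>n. f (restrict (H n x) I)) \<longlonglongrightarrow> f (restrict (L x) I)"
      proof (rule AE_I2)
        fix x assume x: "x \<in> space N"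
        have "(\<lambda>n. restrict (H n x) I) \<longlonglongrightarrow> restrict (L x) I"
          by (rule tendsto_fun) (auto simp: restrict_def lim x)
        then show "(\<lambda>n. f (restrict (H n x) I)) \<longlonglongrightarrow> f (restrict (L x) I)"
          using f continuous_on_tendsto_compose[of UNIV f "\<lambda>n. restrict (H n x) I"] by simp
      qed
      show "(\<lambda>x. f (restrict (L x) I)) \<in> borel_measurable N"
        by (rule measurable_compose[OF rm[OF Lm] fm])
      show "(\<lambda>x. f (restrict (H n x) I)) \<in> borel_measurable N" for n
        by (rule measurable_compose[OF rm[OF m] fm])
    qed (simp_all add: b del: real_norm_def)
    also have "(\<integral>x. f (restrict (L x) I) \<partial>N) = (\<integral>x. f x \<partial>\<nu>)"
      unfolding \<nu>_def by (rule integral_distr[OF rm[OF Lm] fm, symmetric])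
    finally have "(\<lambda>n. E (Suc n) f) \<longlonglongrightarrow> (\<integral>x. f x \<partial>\<nu>)"
      using f by (simp only: law)
    then show "(\<lambda>t. E t f) \<longlonglongrightarrow> (\<integral>x. f x \<partial>\<nu>)" by (rule LIMSEQ_imp_Suc)
  qed
qed

text \<open>Finite product measures are determined on boxes, and the preimage of a box under a
  coordinatewise map is a box.\<close>

lemma distr_PiM_map:
  assumes J: "finite J" and M: "\<And>i. prob_space (M i)" and g: "\<And>i. g i \<in> measurable (M i) (N i)"
  shows "distr (PiM J M) (PiM J N) (\<lambda>x. \<lambda>i\<in>J. g i (x i)) = PiM J (\<lambda>i. distr (M i) (N i) (g i))"
proof -
  interpret M: product_prob_space M by (rule product_prob_spaceI[OF M])
  interpret D: product_prob_space "\<lambda>i. distr (M i) (N i) (g i)"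
    by (rule product_prob_spaceI[OF prob_space.prob_space_distr[OF M g]])
  have m: "(\<lambda>x. \<lambda>i\<in>J. g i (x i)) \<in> measurable (PiM J M) (PiM J N)"
    using g by (intro measurable_restrict) (auto intro: measurable_compose[OF measurable_component_singleton])
  show ?thesis
  proof (rule D.PiM_eqI[OF J])
    show "sets (distr (PiM J M) (PiM J N) (\<lambda>x. \<lambda>i\<in>J. g i (x i))) = sets (PiM J (\<lambda>i. distr (M i) (N i) (g i)))"
      by (auto intro!: sets_PiM_cong)
    fix A assume "\<And>i. i \<in> J \<Longrightarrow> A i \<in> sets (distr (M i) (N i) (g i))"
    then have A: "\<And>i. i \<in> J \<Longrightarrow> A i \<in> sets (N i)" by simp
    have "(\<lambda>x. \<lambda>i\<in>J. g i (x i)) -` Pi\<^sub>E J A \<inter> space (PiM J M) = Pi\<^sub>E J (\<lambda>i. g i -` A i \<inter> space (M i))"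
      by (auto simp: space_PiM PiE_iff)
    then have "emeasure (distr (PiM J M) (PiM J N) (\<lambda>x. \<lambda>i\<in>J. g i (x i))) (Pi\<^sub>E J A) =
        emeasure (PiM J M) (Pi\<^sub>E J (\<lambda>i. g i -` A i \<inter> space (M i)))"
      using A J by (subst emeasure_distr[OF m]) (auto intro: sets_PiM_I_finite)
    also have "\<dots> = (\<Prod>i\<in>J. emeasure (M i) (g i -` A i \<inter> space (M i)))"
      using A J measurable_sets[OF g] by (intro M.emeasure_PiM) auto
    also have "\<dots> = (\<Prod>i\<in>J. emeasure (distr (M i) (N i) (g i)) (A i))"
      using A g by (intro prod.cong) (auto simp: emeasure_distr)
    finally show "emeasure (distr (PiM J M) (PiM J N) (\<lambda>x. \<lambda>i\<in>J. g i (x i))) (Pi\<^sub>E J A) =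
      (\<Prod>i\<in>J. emeasure (distr (M i) (N i) (g i)) (A i))" .
  qed
qed

section \<open>Gaussian generators of a window\<close>

context noisy_channel
begin

text \<open>Variance of the state at time n + 1 started from the constant s; as a geometric sum it
  has a visible limit for |c| < 1.\<close>

definition Svar :: "nat \<Rightarrow> real" where
  "Svar n = KW * (\<Sum>i<n. (c\<^sup>2) ^ i)"

lemma Svar_Suc: "Svar (Suc n) = c\<^sup>2 * Svar n + KW"
  unfolding Svar_def by (subst sum.lessThan_Suc_shift) (simp add: sum_distrib_left algebra_simps)

lemma expectation_iexp_S: "expectation (\<lambda>\<omega>. iexp (u * S n \<omega>)) = iexp (u * (c ^ n * s)) * gchar (Svar n) u"
proof (induction n arbitrary: u)
  case 0
  then show ?case by (simp add: gchar_def Svar_def prob_space)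
next
  case (Suc n)
  have "expectation (\<lambda>\<omega>. iexp (u * S (Suc n) \<omega>)) =
    expectation (\<lambda>\<omega>. iexp ((u * c) * S n \<omega>) * (iexp (u * W (Suc n) \<omega>) * 1))"
    by (intro Bochner_Integration.integral_cong refl) (simp add: distrib_left exp_add mult.assoc)
  also have "\<dots> = expectation (\<lambda>\<omega>. iexp ((u * c) * S n \<omega>)) * (expectation (\<lambda>\<omega>. iexp (u * W (Suc n) \<omega>)) * expectation (\<lambda>\<omega>. 1))"
    by (rule expectation_past_noise[where p = "\<lambda>x. iexp (u * x)" and q = "\<lambda>_. 1" and bf = 1 and bp = 1 and bq = 1])
      (use S_past[of n] in auto)
  also have "\<dots> = iexp ((u * c) * (c ^ n * s)) * (gchar (Svar n) (u * c) * gchar KW u)"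
    unfolding Suc expectation_iexp_W by (simp add: prob_space)
  also have "gchar (Svar n) (u * c) * gchar KW u = gchar (Svar (Suc n)) u"
    unfolding gchar_mult by (simp add: gchar_def Svar_Suc power_mult_distrib algebra_simps)
  finally show ?case by (simp add: mult_ac)
qed

lemma est_measurable [measurable]: "est n \<in> borel_measurable M"
  unfolding est_def[abs_def] by simp

lemma err_distr: "distr M borel (err n) = gauss 0 (K n)"
  using filter_inv[of n] unfolding filter_inv_def
  by (intro distr_eq_gaussI K_nonneg) auto

text \<open>Deconvolution: the state is the sum of the independent variables \<open>est n\<close>
  and \<open>err n\<close>, and the transform of the error never vanishes, so that of the estimate
  is a quotient.\<close>

lemma est_distr: "Svar n - K n \<ge> 0" "distr M borel (est n) = gauss (c ^ n * s) (Svar n - K n)"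
proof -
  have char: "expectation (\<lambda>\<omega>. iexp (u * est n \<omega>)) = iexp (u * (c ^ n * s)) * gchar (Svar n - K n) u" for u
  proof -
    have "iexp (u * (c ^ n * s)) * gchar (Svar n) u = expectation (\<lambda>\<omega>. iexp (u * est n \<omega>) * iexp (u * err n \<omega>))"
      unfolding expectation_iexp_S[symmetric]
      by (intro Bochner_Integration.integral_cong refl) (simp add: est_def flip: exp_add distrib_left of_real_add)
    also have "\<dots> = expectation (\<lambda>\<omega>. iexp (u * est n \<omega>)) * gchar (K n) u"
      using est_outputs[of n] by (intro filter_inv_expectation[OF filter_inv, where b = 1]) auto
    finally have "expectation (\<lambda>\<omega>. iexp (u * est n \<omega>)) * gchar (K n) u = iexp (u * (c ^ n * s)) * gchar (Svar n) u" ..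
    moreover have "gchar (Svar n) u = gchar (Svar n - K n) u * gchar (K n) u"
      unfolding gchar_mult by (simp add: gchar_def algebra_simps)
    moreover have "gchar (K n) u \<noteq> 0" by (simp add: gchar_def)
    ultimately show ?thesis by simp
  qed
  \<comment> \<open>A characteristic function has modulus at most 1; evaluating at u = 1 yields the
    sign of the variance.\<close>
  have "norm (expectation (\<lambda>\<omega>. iexp (1 * est n \<omega>))) \<le> expectation (\<lambda>\<omega>. norm (iexp (1 * est n \<omega>)))"
    by (rule integral_norm_bound)
  then have "exp (- (Svar n - K n) / 2) \<le> 1"
    unfolding char by (simp add: norm_mult gchar_def prob_space)
  then show v: "Svar n - K n \<ge> 0" by simp
  show "distr M borel (est n) = gauss (c ^ n * s) (Svar n - K n)"
    by (rule distr_eq_gaussI[OF _ v char]) simp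
qed

text \<open>The independent Gaussian variables that generate the window of length m starting at
  time n + 1: est n, err n, and the noises at times n + 1, ..., n + m.\<close>
fun gen :: "nat \<Rightarrow> bool + (nat + nat) \<Rightarrow> 'w \<Rightarrow> real" where
  "gen n (Inl True) = est n"
| "gen n (Inl False) = err n"
| "gen n (Inr i) = noise_rv (shift n i)"

fun gen_mean :: "nat \<Rightarrow> bool + (nat + nat) \<Rightarrow> real" where
  "gen_mean n (Inl True) = c ^ n * s"
| "gen_mean n _ = 0"

fun gen_var :: "nat \<Rightarrow> bool + (nat + nat) \<Rightarrow> real" where
  "gen_var n (Inl True) = Svar n - K n"
| "gen_var n (Inl False) = K n"
| "gen_var n (Inr (Inl _)) = KW"
| "gen_var n (Inr (Inr _)) = KZ"

definition gen_index :: "nat \<Rightarrow> (bool + (nat + nat)) set" where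
  "gen_index m = insert (Inl True) (insert (Inl False) (Inr ` (Inl ` {1..m} \<union> Inr ` {1..m})))"

lemma gen_distr:
  assumes "i \<in> gen_index m"
  shows "gen n i \<in> borel_measurable M" "distr M borel (gen n i) = gauss (gen_mean n i) (gen_var n i)"
  using assms W_distr Z_distr est_distr(2) err_distr by (auto simp: gen_index_def)

text \<open>The later noises are independent of \<open>past n\<close>, which carries both estimate
  and error; these two are separated by \<open>filter_inv\<close>. Accordingly \<open>None\<close>
  stands for the intersection of their events.\<close>

lemma gen_indep: "indep_vars (\<lambda>_. borel) (gen n) (gen_index m)"
  unfolding indep_vars_def2
proof (intro conjI ballI)
  let ?N = "Inl ` {1..m} \<union> Inr ` {1..m} :: (nat + nat) set"
  let ?V = "\<lambda>i. {gen n i -` A \<inter> space M | A. A \<in> sets borel}"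
  let ?P = "\<lambda>j. case j of None \<Rightarrow> sets (past n)
       | Some i \<Rightarrow> {noise_rv (shift n i) -` A \<inter> space M | A. A \<in> sets borel}"
  show "gen n i \<in> borel_measurable M" if "i \<in> gen_index m" for i by (rule gen_distr[OF that])
  then have V: "?V i \<subseteq> events" if "i \<in> gen_index m" for i using that by (auto intro: measurable_sets)
  show "indep_sets ?V (gen_index m)"
  proof (subst indep_sets_finite)
    show "gen_index m \<noteq> {}" "finite (gen_index m)" by (auto simp: gen_index_def)
    show "space M \<in> ?V i" for i by (auto intro!: exI[of _ UNIV])
    show "\<forall>A\<in>Pi (gen_index m) ?V. prob (\<Inter>j\<in>gen_index m. A j) = (\<Prod>j\<in>gen_index m. prob (A j))"
    proof
      fix A assume A: "A \<in> Pi (gen_index m) ?V"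
      let ?A = "\<lambda>j. case j of None \<Rightarrow> A (Inl True) \<inter> A (Inl False) | Some i \<Rightarrow> A (Inr i)"
      have AT: "A (Inl True) \<in> ?V (Inl True)" and AF: "A (Inl False) \<in> ?V (Inl False)"
        using A by (auto simp: gen_index_def Pi_iff)
      have AN: "A (Inr i) \<in> ?V (Inr i)" if "i \<in> ?N" for i
        using A that by (auto simp: gen_index_def Pi_iff)
      have T: "A (Inl True) \<in> sets (outputs n)"
        using AT measurable_sets[OF est_outputs] by (auto simp: past_sigma_sets(2))
      have Fp: "A (Inl False) \<in> sets (past n)"
        using AF measurable_sets[OF err_past] by (auto simp: past_sets(2))
      have "prob (\<Inter>j\<in>insert None (Some ` ?N). ?A j) = (\<Prod>j\<in>insert None (Some ` ?N). prob (?A j))"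
      proof (rule indep_setsD[OF future_indep[of n m]])
        show "\<forall>j\<in>insert None (Some ` ?N). ?A j \<in> ?P j"
          using T Fp outputs_past[of n] AN by auto
      qed auto
      also have "\<dots> = prob (A (Inl True) \<inter> A (Inl False)) * (\<Prod>i\<in>?N. prob (A (Inr i)))"
        by (subst prod.insert) (auto simp: prod.reindex)
      also have "prob (A (Inl True) \<inter> A (Inl False)) = prob (A (Inl True)) * prob (A (Inl False))"
        using filter_inv[of n] T AF unfolding filter_inv_def by (intro indep_setD) auto
      also have "prob (A (Inl True)) * prob (A (Inl False)) * (\<Prod>i\<in>?N. prob (A (Inr i))) =
          (\<Prod>j\<in>gen_index m. prob (A j))"
        unfolding gen_index_def by (subst prod.insert, simp, force)+ (simp add: prod.reindex mult.assoc)
      also have "(\<Inter>j\<in>insert None (Some ` ?N). ?A j) = (\<Inter>j\<in>gen_index m. A j)"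
        unfolding gen_index_def by (simp only: INT_insert image_image INT_simps option.case Int_assoc)
      finally show "prob (\<Inter>j\<in>gen_index m. A j) = (\<Prod>j\<in>gen_index m. prob (A j))" .
    qed
  qed (use V in auto)
qed

text \<open>Moves the generators for every starting time n to one probability space on which only
  the affine coefficients depend on n.\<close>

lemma gen_law:
  "distr M (PiM (gen_index m) (\<lambda>_. borel)) (\<lambda>\<omega>. \<lambda>i\<in>gen_index m. gen n i \<omega>) =
   distr (PiM (gen_index m) (\<lambda>_. std_normal_distribution)) (PiM (gen_index m) (\<lambda>_. borel))
     (\<lambda>x. \<lambda>i\<in>gen_index m. gen_mean n i + sqrt (gen_var n i) * x i)"
proof -
  have "distr M (PiM (gen_index m) (\<lambda>_. borel)) (\<lambda>\<omega>. \<lambda>i\<in>gen_index m. gen n i \<omega>) =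
      PiM (gen_index m) (\<lambda>i. distr M borel (gen n i))"
    using gen_indep[of n m] gen_distr
    by (subst (asm) indep_vars_iff_distr_eq_PiM') (auto simp: gen_index_def)
  also have "\<dots> = PiM (gen_index m) (\<lambda>i. distr std_normal_distribution borel (\<lambda>x. gen_mean n i + sqrt (gen_var n i) * x))"
    by (intro PiM_cong refl) (simp add: gen_distr gauss_def)
  also have "\<dots> = distr (PiM (gen_index m) (\<lambda>_. std_normal_distribution)) (PiM (gen_index m) (\<lambda>_. borel))
     (\<lambda>x. \<lambda>i\<in>gen_index m. gen_mean n i + sqrt (gen_var n i) * x i)"
    by (intro distr_PiM_map[symmetric]) (auto simp: gen_index_def prob_space_normal_density)
  finally show ?thesis .
qed

end

section \<open>Windows of the processes as functions of the generators\<close>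

text \<open>The error recursion restarted at the beginning of the window, with the gains as
  parameters because they depend on the starting time. It never reads \<open>b (Inl True)\<close>,
  the estimate, the one generator whose law may diverge.\<close>

primrec err_path :: "(nat \<Rightarrow> real) \<Rightarrow> (nat \<Rightarrow> real) \<Rightarrow> (bool + (nat + nat) \<Rightarrow> real) \<Rightarrow> nat \<Rightarrow> real" where
  "err_path f g b 0 = b (Inl False)"
| "err_path f g b (Suc i) =
     f i * err_path f g b i + (1 - g i) * b (Inr (Inl (Suc i))) - g i * b (Inr (Inr (Suc i)))"

primrec state_path :: "real \<Rightarrow> (bool + (nat + nat) \<Rightarrow> real) \<Rightarrow> nat \<Rightarrow> real" where
  "state_path c b 0 = b (Inl True) + b (Inl False)"
| "state_path c b (Suc i) = c * state_path c b i + b (Inr (Inl (Suc i)))"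

context noisy_channel
begin

lemma gen_index_iff [simp]:
  "Inl t \<in> gen_index m" "Inr (Inl k) \<in> gen_index m \<longleftrightarrow> 1 \<le> k \<and> k \<le> m"
  "Inr (Inr k) \<in> gen_index m \<longleftrightarrow> 1 \<le> k \<and> k \<le> m"
  by (cases t) (auto simp: gen_index_def)

lemma err_path_restrict:
  "i \<le> m \<Longrightarrow> err_path f g (restrict b (gen_index m)) i = err_path f g b i"
  by (induction i) auto

lemma state_path_restrict:
  "i \<le> m \<Longrightarrow> state_path c' (restrict b (gen_index m)) i = state_path c' b i"
  by (induction i) auto

lemma gen_component_measurable:
  "k \<in> gen_index m \<Longrightarrow> (\<lambda>b. b k) \<in> borel_measurable (PiM (gen_index m) (\<lambda>_. borel :: real measure))"
  by (rule measurable_component_singleton)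

lemma err_path_measurable:
  "i \<le> m \<Longrightarrow> (\<lambda>b. err_path f g b i) \<in> borel_measurable (PiM (gen_index m) (\<lambda>_. borel))"
proof (induction i)
  case 0
  then show ?case using gen_component_measurable[of "Inl False" m] by simp
next
  case (Suc i)
  then show ?case
    using gen_component_measurable[of "Inr (Inl (Suc i))" m] gen_component_measurable[of "Inr (Inr (Suc i))" m]
    by simp
qed

lemma state_path_measurable:
  "i \<le> m \<Longrightarrow> (\<lambda>b. state_path c' b i) \<in> borel_measurable (PiM (gen_index m) (\<lambda>_. borel))"
proof (induction i)
  case 0
  then show ?case using gen_component_measurable[of "Inl False" m] gen_component_measurable[of "Inl True" m] by simp
next
  case (Suc i)
  then show ?case using gen_component_measurable[of "Inr (Inl (Suc i))" m] by simp
qed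

lemma err_gen:
  "err (n + i) \<omega> = err_path (\<lambda>i. F (n + i)) (\<lambda>i. G (n + i)) (\<lambda>k. gen n k \<omega>) i"
  by (induction i) auto

lemma S_gen: "S (n + i) \<omega> = state_path c (\<lambda>k. gen n k \<omega>) i"
  by (induction i) (auto simp: est_def)

lemma err_path_convergent:
  assumes "\<And>i. convergent (\<lambda>n. f n i)" "\<And>i. convergent (\<lambda>n. g n i)"
    and "\<And>k. k \<noteq> Inl True \<Longrightarrow> convergent (\<lambda>n. b n k)"
  shows "convergent (\<lambda>n. err_path (f n) (g n) (b n) i)"
  by (induction i) (auto intro!: convergent_add convergent_diff convergent_mult convergent_const assms)

lemma state_path_convergent:
  assumes "\<And>k. convergent (\<lambda>n. b n k)"
  shows "convergent (\<lambda>n. state_path c' (b n) i)"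
  by (induction i) (auto intro!: convergent_add convergent_mult convergent_const assms)

text \<open>Here \<open>\<Theta> n (j, i)\<close> expresses component j at offset i of the window
  starting at time n + 1. By \<open>restr\<close> and \<open>meas\<close> it is a measurable
  function of finitely many generators, so \<open>gen_law\<close> determines the law of the window;
  \<open>conv\<close> asks for convergence at each sample x of the normals.\<close>

lemma asymp_stationaryI:
  fixes U :: "nat \<Rightarrow> nat \<Rightarrow> 'w \<Rightarrow> real"
    and \<Theta> :: "nat \<Rightarrow> nat \<times> nat \<Rightarrow> (bool + (nat + nat) \<Rightarrow> real) \<Rightarrow> real"
  assumes U: "\<And>j i n. j < d \<Longrightarrow> AE \<omega> in M. U j (Suc (n + i)) \<omega> = \<Theta> n (j, i) (\<lambda>k. gen n k \<omega>)"
    and Um: "\<And>j t. j < d \<Longrightarrow> U j (Suc t) \<in> borel_measurable M"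
    and restr: "\<And>j i n m b. j < d \<Longrightarrow> i < m \<Longrightarrow> \<Theta> n (j, i) (restrict b (gen_index m)) = \<Theta> n (j, i) b"
    and meas: "\<And>j i n m. j < d \<Longrightarrow> i < m \<Longrightarrow>
      \<Theta> n (j, i) \<in> borel_measurable (PiM (gen_index m) (\<lambda>_. borel))"
    and conv: "\<And>j i x. j < d \<Longrightarrow>
      convergent (\<lambda>n. \<Theta> n (j, i) (\<lambda>k. gen_mean n k + sqrt (gen_var n k) * x k))"
  shows "asymp_stationary M d U"
  unfolding asymp_stationary_def
proof
  fix m
  let ?I = "{..<d} \<times> {..<m}" and ?J = "gen_index m"
  let ?B = "PiM ?J (\<lambda>_. borel :: real measure)"
  let ?N = "PiM ?J (\<lambda>_. std_normal_distribution)"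
  let ?A = "\<lambda>n x. \<lambda>k\<in>?J. gen_mean n k + sqrt (gen_var n k) * x k"
  let ?R = "\<lambda>n b. restrict (\<lambda>p. \<Theta> n p b) ?I"
  have A: "?A n \<in> measurable ?N ?B" for n
    by (intro measurable_restrict borel_measurable_add borel_measurable_times borel_measurable_const
        measurable_compose[OF measurable_component_singleton, of _ _ _ "\<lambda>x. x"]) auto
  have gm: "(\<lambda>\<omega>. \<lambda>k\<in>?J. gen n k \<omega>) \<in> measurable M ?B" for n
    by (intro measurable_restrict gen_distr(1))
  have R: "?R n \<in> measurable ?B (PiM ?I (\<lambda>_. borel))" for n
    using meas by (intro measurable_restrict) auto
  have AR: "\<Theta> n (j, i) (?A n x) = \<Theta> n (j, i) (\<lambda>k. gen_mean n k + sqrt (gen_var n k) * x k)"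
    if "j < d" "i < m" for n j i x using restr[OF that] .
  show "\<exists>\<nu>. prob_space \<nu> \<and> sets \<nu> = sets (PiM ?I (\<lambda>_. borel)) \<and>
    (\<forall>f :: (nat \<times> nat \<Rightarrow> real) \<Rightarrow> real. continuous_on UNIV f \<and> bounded (range f) \<longrightarrow>
      (\<lambda>t. \<integral>\<omega>. f (restrict (\<lambda>(j, i). U j (t + i) \<omega>) ?I) \<partial>M) \<longlonglongrightarrow> (\<integral>x. f x \<partial>\<nu>))"
  proof (rule limit_law_exists)
    show "prob_space ?N" by (intro prob_space_PiM prob_space_normal_density) simp
    fix p assume p: "p \<in> ?I"
    show "(\<lambda>x. \<Theta> n p (?A n x)) \<in> borel_measurable ?N" for n
      using p by (cases p) (auto intro!: measurable_compose[OF A meas])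
    fix x assume "x \<in> space ?N"
    show "(\<lambda>n. \<Theta> n p (?A n x)) \<longlonglongrightarrow> lim (\<lambda>n. \<Theta> n p (?A n x))"
      using p conv[of "fst p" "snd p" x] by (cases p) (auto simp: AR convergent_LIMSEQ_iff simp del: restrict_apply)
  next
    fix n and f :: "(nat \<times> nat \<Rightarrow> real) \<Rightarrow> real" assume f: "continuous_on UNIV f" "bounded (range f)"
    have fm: "f \<in> borel_measurable (PiM ?I (\<lambda>_. borel))"
      by (rule continuous_on_fun_borel_measurable_PiM[OF f(1)])
    have fR: "(\<lambda>b. f (?R n b)) \<in> borel_measurable ?B" by (rule measurable_compose[OF R fm])
    have "(\<integral>\<omega>. f (restrict (\<lambda>(j, i). U j (Suc n + i) \<omega>) ?I) \<partial>M) =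
      (\<integral>\<omega>. f (?R n (\<lambda>k\<in>?J. gen n k \<omega>)) \<partial>M)"
    proof (rule integral_cong_AE)
      show "(\<lambda>\<omega>. f (restrict (\<lambda>(j, i). U j (Suc n + i) \<omega>) ?I)) \<in> borel_measurable M"
        using Um by (intro measurable_compose[OF measurable_restrict fm]) auto
      show "(\<lambda>\<omega>. f (?R n (\<lambda>k\<in>?J. gen n k \<omega>))) \<in> borel_measurable M"
        by (rule measurable_compose[OF gm fR])
      have "AE \<omega> in M. \<forall>p\<in>?I. U (fst p) (Suc (n + snd p)) \<omega> = \<Theta> n (fst p, snd p) (\<lambda>k. gen n k \<omega>)"
        using U by (intro AE_finite_allI) auto
      then show "AE \<omega> in M. f (restrict (\<lambda>(j, i). U j (Suc n + i) \<omega>) ?I) = f (?R n (\<lambda>k\<in>?J. gen n k \<omega>))"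
      proof eventually_elim
        case (elim \<omega>)
        have "restrict (\<lambda>(j, i). U j (Suc n + i) \<omega>) ?I = ?R n (\<lambda>k\<in>?J. gen n k \<omega>)"
          by (rule restrict_ext) (use elim restr in auto)
        then show ?case by (rule arg_cong)
      qed
    qed
    also have "\<dots> = (\<integral>b. f (?R n b) \<partial>distr M ?B (\<lambda>\<omega>. \<lambda>k\<in>?J. gen n k \<omega>))"
      by (rule integral_distr[OF gm fR, symmetric])
    also have "\<dots> = (\<integral>x. f (?R n (?A n x)) \<partial>?N)"
      unfolding gen_law by (rule integral_distr[OF A fR])
    finally show "(\<integral>\<omega>. f (restrict (\<lambda>(j, i). U j (Suc n + i) \<omega>) ?I) \<partial>M) =
      (\<integral>x. f (restrict ((\<lambda>n x p. \<Theta> n p (?A n x)) n x) ?I) \<partial>?N)" .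
  qed
qed

lemma Xproc_measurable: "Xproc M a c Lam s W Z (Suc n) \<in> borel_measurable M"
  using Shat_measurable[of n] by (auto simp: Xproc_def Sproc_def)

lemma Iproc_measurable: "Iproc M a c Lam s W Z (Suc n) \<in> borel_measurable M"
  using Shat_measurable[of n] Yproc_AE(1)[of "Suc n"] by (simp add: Iproc_def)

section \<open>Convergent gains and parameters, and the two stationarity statements\<close>

context
  assumes P: "(Lam, KZ) \<in> Pinf a c KW"
begin

lemma K_lim: "K \<longlonglongrightarrow> Kinf a c KW Lam KZ"
  by (rule Kop_tendsto(1)[OF KW P])

lemma G_convergent: "convergent (\<lambda>n. G (n + i))"
proof -
  have "Kinf a c KW Lam KZ \<ge> 0" using Kop_tendsto(2)[OF KW P] by (simp add: stab_sol_def)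
  then have "KZ + KW + (Lam + c - a)\<^sup>2 * Kinf a c KW Lam KZ > 0"
    using KW KZ by (intro add_pos_nonneg add_nonneg_pos) auto
  then have "G \<longlonglongrightarrow> gainM a c KW Lam KZ (Kinf a c KW Lam KZ)"
    unfolding gainM_def by (intro tendsto_intros K_lim) auto
  then show ?thesis unfolding convergent_def using LIMSEQ_ignore_initial_segment by blast
qed

lemma F_convergent: "convergent (\<lambda>n. F (n + i))"
  unfolding closedF_def by (intro convergent_diff convergent_mult convergent_const G_convergent)

text \<open>Error and noises have convergent parameters by \<open>K_lim\<close> and constancy. For
  the estimate the mean \<open>c ^ n * s\<close> and the geometric sum in \<open>Svar\<close>
  converge by |c| < 1.\<close>

lemma base_convergent:
  assumes "k \<noteq> Inl True \<or> \<bar>c\<bar> < 1"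
  shows "convergent (\<lambda>n. gen_mean n k + sqrt (gen_var n k) * x k)"
proof -
  have "convergent (\<lambda>n. gen_mean n k) \<and> convergent (\<lambda>n. gen_var n k)"
  proof (cases "k = Inl True")
    case True
    then have c: "\<bar>c\<bar> < 1" using assms by simp
    have "(\<lambda>n. c ^ n * s) \<longlonglongrightarrow> 0"
      using tendsto_mult_left_zero[OF LIMSEQ_power_zero[of c]] c by simp
    moreover have "(\<lambda>n. \<Sum>i<n. (c\<^sup>2) ^ i) \<longlonglongrightarrow> 1 / (1 - c\<^sup>2)"
      using geometric_sums[of "c\<^sup>2"] c by (simp add: sums_def abs_square_less_1)
    then have "(\<lambda>n. Svar n - K n) \<longlonglongrightarrow> KW * (1 / (1 - c\<^sup>2)) - Kinf a c KW Lam KZ"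
      unfolding Svar_def by (intro tendsto_intros K_lim)
    ultimately show ?thesis using True by (auto simp: convergent_def)
  next
    case False
    have "convergent K" using K_lim by (auto simp: convergent_def)
    with False show ?thesis
      by (cases k; cases "projl k"; cases "projr k") (auto simp: convergent_const)
  qed
  then obtain u v where "(\<lambda>n. gen_mean n k) \<longlonglongrightarrow> u" "(\<lambda>n. gen_var n k) \<longlonglongrightarrow> v"
    by (auto simp: convergent_def)
  then have "(\<lambda>n. gen_mean n k + sqrt (gen_var n k) * x k) \<longlonglongrightarrow> u + sqrt v * x k"
    by (intro tendsto_intros)
  then show ?thesis by (auto simp: convergent_def)
qed

abbreviation "epath n b i \<equiv> err_path (\<lambda>i. F (n + i)) (\<lambda>i. G (n + i)) b i"

lemma epath_convergent:
  "convergent (\<lambda>n. epath n (\<lambda>k. gen_mean n k + sqrt (gen_var n k) * x k) i)"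
  by (intro err_path_convergent F_convergent G_convergent base_convergent) auto

text \<open>Both coordinates are built from the error path and the noises without the estimate, so c
  is unrestricted.\<close>

lemma asymp_stationary_X_I:
  "asymp_stationary M 2 (\<lambda>j. [Xproc M a c Lam s W Z, Iproc M a c Lam s W Z] ! j)"
proof (rule asymp_stationaryI)
  let ?\<Theta> = "\<lambda>n p b. let i = snd p; e = epath n b i; w = b (Inr (Inl (Suc i))); z = b (Inr (Inr (Suc i)))
    in if fst p = 0 then Lam * e + z else (Lam + c - a) * e + w + z"
  fix j assume "j < (2::nat)"
  then have j: "j = 0 \<or> j = 1" by auto
  show "AE \<omega> in M. ([Xproc M a c Lam s W Z, Iproc M a c Lam s W Z] ! j) (Suc (n + i)) \<omega> =
      ?\<Theta> n (j, i) (\<lambda>k. gen n k \<omega>)" for i n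
    using j Xproc_AE[of "n + i"] Iproc_AE[of "n + i"] by (auto simp: Let_def err_gen)
  show "([Xproc M a c Lam s W Z, Iproc M a c Lam s W Z] ! j) (Suc t) \<in> borel_measurable M" for t
    using j Xproc_measurable Iproc_measurable by auto
  show "i < m \<Longrightarrow> ?\<Theta> n (j, i) (restrict b (gen_index m)) = ?\<Theta> n (j, i) b" for i n m b
    by (simp add: Let_def err_path_restrict)
  show "i < m \<Longrightarrow> ?\<Theta> n (j, i) \<in> borel_measurable (PiM (gen_index m) (\<lambda>_. borel))" for i n m
    using err_path_measurable[of i m] gen_component_measurable[of "Inr (Inl (Suc i))" m]
      gen_component_measurable[of "Inr (Inr (Suc i))" m] by (simp add: Let_def)
  show "convergent (\<lambda>n. ?\<Theta> n (j, i) (\<lambda>k. gen_mean n k + sqrt (gen_var n k) * x k))" for i x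
    using j by (auto simp: Let_def simp del: gen_mean.simps gen_var.simps
      intro!: convergent_add convergent_mult convergent_const epath_convergent base_convergent)
qed

text \<open>State, noise and output contain the state path, which starts from estimate plus error;
  this is where convergence of the estimate's law is used.\<close>

lemma asymp_stationary_S_V_X_Y:
  assumes c: "\<bar>c\<bar> < 1"
  shows "asymp_stationary M 4 (\<lambda>j. [Sproc c s W, Vproc a c s W,
    Xproc M a c Lam s W Z, Yproc M a c Lam s W Z] ! j)"
proof (rule asymp_stationaryI)
  let ?U = "[Sproc c s W, Vproc a c s W, Xproc M a c Lam s W Z, Yproc M a c Lam s W Z]"
  let ?\<Theta> = "\<lambda>n p b. let i = snd p; e = epath n b i; x = state_path c b i;
      w = b (Inr (Inl (Suc i))); z = b (Inr (Inr (Suc i)))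
    in if fst p = 0 then x else if fst p = 1 then (c - a) * x + w else if fst p = 2 then Lam * e + z
       else Lam * e + z + ((c - a) * x + w)"
  fix j assume "j < (4::nat)"
  then have j: "j = 0 \<or> j = 1 \<or> j = 2 \<or> j = 3" by auto
  show "AE \<omega> in M. (?U ! j) (Suc (n + i)) \<omega> = ?\<Theta> n (j, i) (\<lambda>k. gen n k \<omega>)" for i n
  proof -
    have "AE \<omega> in M. Yproc M a c Lam s W Z (Suc (n + i)) \<omega> = obs (Suc (n + i)) \<omega>"
      by (rule Yproc_AE(2)) simp
    then show ?thesis
      using j Xproc_AE[of "n + i"]
      by (auto simp: Let_def err_gen S_gen Sproc_def Vproc_def obs_def)
  qed
  show "(?U ! j) (Suc t) \<in> borel_measurable M" for t
    using j Xproc_measurable Yproc_AE(1)[of "Suc t"] by (auto simp: Sproc_def Vproc_def)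
  show "i < m \<Longrightarrow> ?\<Theta> n (j, i) (restrict b (gen_index m)) = ?\<Theta> n (j, i) b" for i n m b
    by (simp add: Let_def err_path_restrict state_path_restrict)
  show "i < m \<Longrightarrow> ?\<Theta> n (j, i) \<in> borel_measurable (PiM (gen_index m) (\<lambda>_. borel))" for i n m
    using err_path_measurable[of i m] state_path_measurable[of i m]
      gen_component_measurable[of "Inr (Inl (Suc i))" m]
      gen_component_measurable[of "Inr (Inr (Suc i))" m] by (simp add: Let_def)
  show "convergent (\<lambda>n. ?\<Theta> n (j, i) (\<lambda>k. gen_mean n k + sqrt (gen_var n k) * x k))" for i x
    using j c by (auto simp: Let_def simp del: gen_mean.simps gen_var.simps
      intro!: convergent_add convergent_mult convergent_const epath_convergent state_path_convergent base_convergent)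
qed

end

end

theorem theorem3:
  fixes a c KW kappa :: real
  assumes "c \<noteq> a" and "KW > 0" and "kappa > 0"
    and "Pinf_k a c KW kappa \<noteq> {}"
  shows "(\<forall>s. C_fb a c KW kappa s = C_inf a c KW kappa)
    \<and> (\<forall>Lam KZ. is_maximizer a c KW kappa Lam KZ \<longrightarrow>
         (\<forall>(M :: 'w measure) W Z s. noise_model M KW KZ W Z \<longrightarrow>
            (\<bar>c\<bar> < 1 \<longrightarrow>
               asymp_stationary M 4 (\<lambda>j. [Sproc c s W, Vproc a c s W,
                  Xproc M a c Lam s W Z, Yproc M a c Lam s W Z] ! j))
          \<and> asymp_stationary M 2 (\<lambda>j. [Xproc M a c Lam s W Z, Iproc M a c Lam s W Z] ! j)))"
proof (intro conjI allI impI)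
  show "C_fb a c KW kappa s = C_inf a c KW kappa" for s
    by (rule C_fb_eq_C_inf[OF \<open>KW > 0\<close>])
  fix Lam KZ s and M :: "'w measure" and W Z
  assume "is_maximizer a c KW kappa Lam KZ" and noise: "noise_model M KW KZ W Z"
  then have P: "(Lam, KZ) \<in> Pinf a c KW" by (simp add: is_maximizer_def Pinf_k_def)
  then have "KZ \<ge> 0" using \<open>KW > 0\<close> by (simp add: Pinf_iff)
  moreover have "prob_space M" using noise by (simp add: noise_model_def)
  ultimately interpret noisy_channel M a c KW Lam KZ s W Z
    using noise \<open>KW > 0\<close> by (intro noisy_channel.intro noisy_channel_axioms.intro)
  show "asymp_stationary M 2 (\<lambda>j. [Xproc M a c Lam s W Z, Iproc M a c Lam s W Z] ! j)"
    by (rule asymp_stationary_X_I[OF P])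
  show "asymp_stationary M 4 (\<lambda>j. [Sproc c s W, Vproc a c s W,
      Xproc M a c Lam s W Z, Yproc M a c Lam s W Z] ! j)" if "\<bar>c\<bar> < 1"
    by (rule asymp_stationary_S_V_X_Y[OF P that])
qed

end
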